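(* Let $m\ge1$, let $\varrho$ be a tensor-product probability measure on $\mathcal U=[-1,1]^{\mathbb N}$ and let $0<p<1$. Then the following hold. (a) The $m$-width $\theta_m(p)$ satisfies $$\theta_m(p)\ \ge\ c\cdot 2^{1/2-2/p},$$ where $c>0$ depends on the measure $\varrho$ only. (b) The $m$-width $\theta_m(p,\mathsf M)$ satisfies $$\theta_m(p,\mathsf M)\ \ge\ \overline{\theta_m}(p,\mathsf M)\ \ge\ c\cdot2^{-1/p}\cdot m^{1/2-1/p},$$ where $c>0$ depends on the measure $\varrho$ only.
   Context: Setting. $(\mathcal V,\|\cdot\|_{\mathcal V})$ is a Banach space and $\mathcal U=[-1,1]^{\mathbb N}$. A tensor-product probability measure on $\mathcal U$ is a measure $\varrho=\rho\times\rho\times\cdots$, where $\rho$ is a (nonnegative) Borel probability measure on $[-1,1]$. $L^2_\varrho(\mathcal U;\mathcal V)$ is the Lebesgue–Bochner space of (equivalence classes of) strongly $\varrho$-measurable $f:\mathcal U\to\mathcal V$ with finite norm $(\int_{\mathcal U}\|f(\boldsymbol y)\|_{\mathcal V}^2\,d\varrho(\boldsymbol y))^{1/2}$; $L^2_\varrho(\mathcal U)=L^2_\varrho(\mathcal U;\mathbb R)$. Sequence spaces. For a real sequence $\boldsymbol z=(z_i)_{i\in\mathbb N}$, its minimal monotone majorant is $\tilde{\boldsymbol z}=(\tilde z_i)_{i\in\mathbb N}$, $\tilde z_i=\sup_{j\ge i}|z_j|$. For $0<p<\infty$, $\ell^p_{\mathsf M}(\mathbb N)=\{\boldsymbol z\in\ell^\infty(\mathbb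 N):\|\boldsymbol z\|_{p,\mathsf M}:=\|\tilde{\boldsymbol z}\|_p<\infty\}$. Holomorphic classes. For $r>1$ let $\mathcal E_r=\{\tfrac12(z+z^{-1}):z\in\mathbb C,\ 1\le|z|\le r\}$ and let $\mathcal E_1=[-1,1]$; for $\boldsymbol r=(r_j)_{j\in\mathbb N}\in[1,\infty)^{\mathbb N}$ let $\mathcal E_{\boldsymbol r}=\mathcal E_{r_1}\times\mathcal E_{r_2}\times\cdots\subset\mathbb C^{\mathbb N}$. For $\boldsymbol b\in[0,\infty)^{\mathbb N}$ let $\mathcal R(\boldsymbol b)=\bigcup\{\mathcal E_{\boldsymbol r}:\boldsymbol r\in[1,\infty)^{\mathbb N},\ \sum_{i=1}^\infty(\tfrac{r_i+r_i^{-1}}2-1)b_i\le1\}$. A function $f:\mathcal U\to\mathcal V$ is $(\boldsymbol b,1)$-holomorphic if it is holomorphic in $\mathcal R(\boldsymbol b)$. $\mathcal H(\boldsymbol b)$ is the set of $(\boldsymbol b,1)$-holomorphic $f:\mathcal U\to\mathcal V$ with $\|f\|_{L^\infty(\mathcal R(\boldsymbol b);\mathcal V)}:=\operatorname{ess\,sup}_{\boldsymbol z\in\mathcal R(\boldsymbol b)}\|f(\boldsymbol z)\|_{\mathcal V}\le1$. Further, $\mathcal H(p)=\bigcup\{\mathcal H(\boldsymbol b):\boldsymbol b\in\ell^p(\mathbb N)\cap[0,\infty)^{\mathbb N},\|\boldsymbol b\|_p\le1\}$ and $\mathcal H(p,\mathsf M)=\bigcup\{\mathcal H(\boldsymbol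 b):\boldsymbol b\in\ell^p_{\mathsf M}(\mathbb N)\cap[0,\infty)^{\mathbb N},\|\boldsymbol b\|_{p,\mathsf M}\le1\}$. Adaptive sampling operators. For a normed vector space $\mathcal Y$, a scalar-valued adaptive sampling operator is a map $\mathcal L:\mathcal Y\to\mathbb R^m$ of the form $\mathcal L(f)=(L_1(f),L_2(f;L_1(f)),\ldots,L_m(f;L_1(f),\ldots,L_{m-1}(f)))$, where $L_1:\mathcal Y\to\mathbb R$ is a bounded linear functional and, for $i=2,\dots,m$, $L_i:\mathcal Y\times\mathbb R^{i-1}\to\mathbb R$ is bounded and linear in its first component. For a vector space $\mathcal Y\subseteq L^2_\varrho(\mathcal U;\mathcal V)$ with norm $\|\cdot\|_{\mathcal Y}$, a Banach-valued adaptive sampling operator is a map $\mathcal L:\mathcal Y\to\mathcal V^m$ of the same form, with $L_1:\mathcal Y\to\mathcal V$ a bounded linear operator and, for $i=2,\dots,m$, $L_i:\mathcal Y\times\mathcal V^{i-1}\to\mathcal V$ a bounded linear operator in its first component, satisfying: there exist $v,w\in\mathcal V\setminus\{0\}$, a normed vector space $\widetilde{\mathcal Y}\subseteq L^2_\varrho(\mathcal U)$ and a scalar-valued adaptive sampling operator $\widetilde{\mathcal L}:\widetilde{\mathcal Y}\to\mathbb R^m$ such that if $vg\in\mathcal Y$ for some $g\in L^2_\varrho(\mathcal U)$ then $g\in\widetilde{\mathcal Y}$ and $\mathcal L(vg)=w\widetilde{\mathcal L}(g)$ (where $w\boldsymbol x=(wx_i)_{i=1}^m\in\mathcal V^m$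 for $\boldsymbol x\in\mathbb R^m$). Widths. Let $\mathcal X=L^2_\varrho(\mathcal U;\mathcal V)$ and let $\mathcal Y$ be a normed vector subspace of $\mathcal X$. For $\mathcal K\subseteq\mathcal Y$, $\Theta_m(\mathcal K;\mathcal Y,\mathcal X)=\inf\{\sup_{f\in\mathcal K}\|f-\mathcal T(\mathcal L(f))\|_{\mathcal X}\}$, the infimum being over all Banach-valued adaptive sampling operators $\mathcal L:\mathcal Y\to\mathcal V^m$ and arbitrary maps $\mathcal T:\mathcal V^m\to\mathcal X$. Set $\theta_m(\boldsymbol b)=\Theta_m(\mathcal H(\boldsymbol b);\mathcal Y,\mathcal X)$, $\overline{\theta_m}(p,\mathsf M)=\sup\{\theta_m(\boldsymbol b):\boldsymbol b\in\ell^p_{\mathsf M}(\mathbb N)\cap[0,\infty)^{\mathbb N},\|\boldsymbol b\|_{p,\mathsf M}\le1\}$, $\theta_m(p)=\Theta_m(\mathcal H(p);\mathcal Y,\mathcal X)$ and $\theta_m(p,\mathsf M)=\Theta_m(\mathcal H(p,\mathsf M);\mathcal Y,\mathcal X)$. The bounds hold for any choice of the normed vector space $\mathcal Y$ that contains the class in question ($\mathcal H(p)$ in (a), $\mathcal H(p,\mathsf M)$ in (b)).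
   Formalization: The measure ρ is assumed not to be a point mass (for a point mass all widths vanish when Y is the whole L² space, so the bounds fail); c is uniform over all closed subspaces V of one arbitrary complex Banach space, which gives uniformity over all V by direct sums. *)

theory Defs
  imports "HOL-Probability.Probability"
begin

section \<open>Complex Banach spaces\<close>

text \<open>
  A complex Banach space is a real one with a compatible scalar multiplication by complex numbers.
  The value space of the functions below is a closed complex subspace \<open>V\<close> of such a type, not the
  whole type, so that one constant can be asserted for all \<open>V\<close> inside a single formula; \<open>V = UNIV\<close>
  is allowed.
\<close>

class complex_banach = banach +
  fixes scaleC :: "complex \<Rightarrow> 'a \<Rightarrow> 'a"  (infixr \<open>*\<^sub>C\<close> 75)
  assumes scaleC_add_right: "a *\<^sub>C (x + y) = a *\<^sub>C x + a *\<^sub>C y"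
    and scaleC_add_left: "(a + b) *\<^sub>C x = a *\<^sub>C x + b *\<^sub>C x"
    and scaleC_scaleC: "a *\<^sub>C (b *\<^sub>C x) = (a * b) *\<^sub>C x"
    and scaleC_of_real: "complex_of_real r *\<^sub>C x = r *\<^sub>R x"
    and norm_scaleC: "norm (a *\<^sub>C x) = cmod a * norm x"

instantiation complex :: complex_banach
begin

definition scaleC_complex :: "complex \<Rightarrow> complex \<Rightarrow> complex"
  where "scaleC_complex a x = a * x"

instance
  by standard (simp_all add: scaleC_complex_def algebra_simps norm_mult scaleR_conv_of_real)

end

definition closed_complex_subspace :: "'v::complex_banach set \<Rightarrow> bool"
  where "closed_complex_subspace V \<longleftrightarrow>
    closed V \<and> 0 \<in> V \<and> (\<forall>x\<in>V. \<forall>y\<in>V. x + y \<in> V) \<and> (\<forall>a. \<forall>x\<in>V. a *\<^sub>C x \<in> V)"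


section \<open>Sequence spaces\<close>

definition lp_norm :: "real \<Rightarrow> (nat \<Rightarrow> real) \<Rightarrow> real"
  where "lp_norm p z = (\<Sum>i. \<bar>z i\<bar> powr p) powr (1 / p)"

definition lp_space :: "real \<Rightarrow> (nat \<Rightarrow> real) set"
  where "lp_space p = {z. summable (\<lambda>i. \<bar>z i\<bar> powr p)}"

definition monotone_majorant :: "(nat \<Rightarrow> real) \<Rightarrow> nat \<Rightarrow> real"
  where "monotone_majorant z i = (SUP j\<in>{i..}. \<bar>z j\<bar>)"

definition lpM_norm :: "real \<Rightarrow> (nat \<Rightarrow> real) \<Rightarrow> real"
  where "lpM_norm p z = lp_norm p (monotone_majorant z)"

definition lpM_space :: "real \<Rightarrow> (nat \<Rightarrow> real) set"
  where "lpM_space p = {z. bounded (range z) \<and> monotone_majorant z \<in> lp_space p}"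

definition lp_ball_nonneg :: "real \<Rightarrow> (nat \<Rightarrow> real) set"
  where "lp_ball_nonneg p = {b \<in> lp_space p. (\<forall>i. 0 \<le> b i) \<and> lp_norm p b \<le> 1}"

definition lpM_ball_nonneg :: "real \<Rightarrow> (nat \<Rightarrow> real) set"
  where "lpM_ball_nonneg p = {b \<in> lpM_space p. (\<forall>i. 0 \<le> b i) \<and> lpM_norm p b \<le> 1}"


section \<open>The Lebesgue--Bochner space\<close>

text \<open>If \<open>\<rho>\<close> lives on the space \<open>{-1..1}\<close>, then the space of \<open>tensor_measure \<rho>\<close> is the set of all
  sequences in \<open>[-1,1]\<close>.\<close>

definition tensor_measure :: "real measure \<Rightarrow> (nat \<Rightarrow> real) measure"
  where "tensor_measure \<rho> = (\<Pi>\<^sub>M i\<in>UNIV. \<rho>)"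

text \<open>The library's Bochner integral is restricted to second countable spaces, hence the
  definition of strong measurability from scratch.\<close>

definition strongly_measurable :: "'a measure \<Rightarrow> ('a \<Rightarrow> 'v::topological_space) \<Rightarrow> bool"
  where "strongly_measurable M f \<longleftrightarrow>
    (\<exists>s. (\<forall>n. simple_function M (s n)) \<and> (AE y in M. (\<lambda>n. s n y) \<longlonglongrightarrow> f y))"

text \<open>
  Elements of \<open>L\<^sup>2\<close> are handled through representatives: \<open>L2_space M V\<close> is the set of functions whose
  classes form the Lebesgue--Bochner space of \<open>V\<close>-valued functions. A subspace is accordingly a set
  of functions closed under almost everywhere equality, and its norm vanishes exactly on the
  functions that are zero almost everywhere. The norm need not be related to the \<open>L\<^sup>2\<close> norm.
\<close>

definition L2_space :: "'a measure \<Rightarrow> 'v::real_normed_vector set \<Rightarrow> ('a \<Rightarrow> 'v) set"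
  where "L2_space M V = {f. (\<forall>y\<in>space M. f y \<in> V) \<and> strongly_measurable M f \<and>
    (\<integral>\<^sup>+ y. ennreal ((norm (f y))\<^sup>2) \<partial>M) < \<infinity>}"

definition L2_norm :: "'a measure \<Rightarrow> ('a \<Rightarrow> 'v::real_normed_vector) \<Rightarrow> real"
  where "L2_norm M f = sqrt (enn2real (\<integral>\<^sup>+ y. ennreal ((norm (f y))\<^sup>2) \<partial>M))"

definition normed_L2_subspace ::
    "'a measure \<Rightarrow> 'v::real_normed_vector set \<Rightarrow> ('a \<Rightarrow> 'v) set \<Rightarrow> (('a \<Rightarrow> 'v) \<Rightarrow> real) \<Rightarrow> bool"
  where "normed_L2_subspace M V Y N \<longleftrightarrow>
    Y \<subseteq> L2_space M V \<and>
    (\<forall>f\<in>Y. \<forall>g\<in>L2_space M V. (AE y in M. f y = g y) \<longrightarrow> g \<in> Y) \<and>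
    (\<lambda>y. 0) \<in> Y \<and>
    (\<forall>f\<in>Y. \<forall>g\<in>Y. (\<lambda>y. f y + g y) \<in> Y) \<and>
    (\<forall>c. \<forall>f\<in>Y. (\<lambda>y. c *\<^sub>R f y) \<in> Y) \<and>
    (\<forall>f\<in>Y. 0 \<le> N f) \<and>
    (\<forall>f\<in>Y. N f = 0 \<longleftrightarrow> (AE y in M. f y = 0)) \<and>
    (\<forall>f\<in>Y. \<forall>g\<in>Y. N (\<lambda>y. f y + g y) \<le> N f + N g) \<and>
    (\<forall>c. \<forall>f\<in>Y. N (\<lambda>y. c *\<^sub>R f y) = \<bar>c\<bar> * N f)"


section \<open>Holomorphic classes\<close>

definition ellipse :: "real \<Rightarrow> complex set"
  where "ellipse r =
    (if r = 1 then complex_of_real ` {-1..1}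
     else {(z + inverse z) / 2 | z. 1 \<le> cmod z \<and> cmod z \<le> r})"

definition polyellipse :: "(nat \<Rightarrow> real) \<Rightarrow> (nat \<Rightarrow> complex) set"
  where "polyellipse r = {z. \<forall>j. z j \<in> ellipse (r j)}"

definition holo_region :: "(nat \<Rightarrow> real) \<Rightarrow> (nat \<Rightarrow> complex) set"
  where "holo_region b = \<Union> {polyellipse r | r. (\<forall>j. 1 \<le> r j) \<and>
    (\<Sum>i. ennreal (((r i + inverse (r i)) / 2 - 1) * b i)) \<le> 1}"

definition complex_differentiable_at :: "(complex \<Rightarrow> 'v::complex_banach) \<Rightarrow> complex \<Rightarrow> bool"
  where "complex_differentiable_at F w \<longleftrightarrow> (\<exists>d. (F has_derivative (\<lambda>h. h *\<^sub>C d)) (at w))"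

text \<open>
  Holomorphy is holomorphy with respect to each variable, and a function is holomorphic in a set
  \<open>S\<close> that need not be open if it is holomorphic in some neighbourhood \<open>D\<close> of \<open>S\<close>. Here \<open>D\<close> is open in each
  variable separately, which is what is needed for the partial derivatives to make sense. Requiring
  \<open>D\<close> to be open in the product topology would be much too restrictive, since such sets are unbounded
  in all but finitely many variables.
\<close>

definition holomorphic_in ::
    "'v::complex_banach set \<Rightarrow> (nat \<Rightarrow> complex) set \<Rightarrow> ((nat \<Rightarrow> complex) \<Rightarrow> 'v) \<Rightarrow> bool"
  where "holomorphic_in V S F \<longleftrightarrow> (\<exists>D. S \<subseteq> D \<and>
    (\<forall>z\<in>D. F z \<in> V \<and>
      (\<forall>j. open {w. z(j := w) \<in> D} \<and> complex_differentiable_at (\<lambda>w. F (z(j := w))) (z j))))"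

text \<open>
  Membership in \<open>L2_space M V\<close> is part of the definition: separate holomorphy in infinitely many
  variables does not imply measurability (any function that is unchanged when finitely many
  coordinates are altered is separately holomorphic). There is no canonical measure on
  \<open>holo_region b\<close>; its essential supremum is the supremum.
\<close>

definition holo_class ::
    "(nat \<Rightarrow> real) measure \<Rightarrow> 'v::complex_banach set \<Rightarrow> (nat \<Rightarrow> real) \<Rightarrow> ((nat \<Rightarrow> real) \<Rightarrow> 'v) set"
  where "holo_class M V b = {f \<in> L2_space M V. \<exists>F.
    holomorphic_in V (holo_region b) F \<and>
    (\<forall>y. (\<forall>i. y i \<in> {-1..1}) \<longrightarrow> F (\<lambda>i. complex_of_real (y i)) = f y) \<and>
    (\<forall>z\<in>holo_region b. norm (F z) \<le> 1)}"

definition holo_class_p ::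
    "(nat \<Rightarrow> real) measure \<Rightarrow> 'v::complex_banach set \<Rightarrow> real \<Rightarrow> ((nat \<Rightarrow> real) \<Rightarrow> 'v) set"
  where "holo_class_p M V p = (\<Union>b\<in>lp_ball_nonneg p. holo_class M V b)"

definition holo_class_pM ::
    "(nat \<Rightarrow> real) measure \<Rightarrow> 'v::complex_banach set \<Rightarrow> real \<Rightarrow> ((nat \<Rightarrow> real) \<Rightarrow> 'v) set"
  where "holo_class_pM M V p = (\<Union>b\<in>lpM_ball_nonneg p. holo_class M V b)"


section \<open>Adaptive sampling operators\<close>

definition tuples :: "'v set \<Rightarrow> nat \<Rightarrow> 'v list set"
  where "tuples V m = {h. length h = m \<and> set h \<subseteq> V}"

definition bounded_linear_map_on ::
    "('a \<Rightarrow> 'u::real_normed_vector) set \<Rightarrow> (('a \<Rightarrow> 'u) \<Rightarrow> real) \<Rightarrow> 'v::real_normed_vector set \<Rightarrow>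
     (('a \<Rightarrow> 'u) \<Rightarrow> 'v) \<Rightarrow> bool"
  where "bounded_linear_map_on Y N V A \<longleftrightarrow>
    (\<forall>f\<in>Y. A f \<in> V) \<and>
    (\<forall>f\<in>Y. \<forall>g\<in>Y. A (\<lambda>y. f y + g y) = A f + A g) \<and>
    (\<forall>c. \<forall>f\<in>Y. A (\<lambda>y. c *\<^sub>R f y) = c *\<^sub>R A f) \<and>
    (\<exists>C. \<forall>f\<in>Y. norm (A f) \<le> C * N f)"

text \<open>\<open>L i f h\<close> is the sample number \<open>i\<close> of \<open>f\<close>, counted from \<open>0\<close>, when \<open>h\<close> is the list of the
  \<open>i\<close> samples taken before.\<close>

primrec sample_list :: "(nat \<Rightarrow> 'f \<Rightarrow> 'v list \<Rightarrow> 'v) \<Rightarrow> nat \<Rightarrow> 'f \<Rightarrow> 'v list"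
  where
    "sample_list L 0 f = []"
  | "sample_list L (Suc i) f = sample_list L i f @ [L i f (sample_list L i f)]"

definition adaptive_map ::
    "('a \<Rightarrow> 'u::real_normed_vector) set \<Rightarrow> (('a \<Rightarrow> 'u) \<Rightarrow> real) \<Rightarrow> 'v::real_normed_vector set \<Rightarrow>
     nat \<Rightarrow> (('a \<Rightarrow> 'u) \<Rightarrow> 'v list) \<Rightarrow> bool"
  where "adaptive_map Y N V m S \<longleftrightarrow> (\<exists>L.
    (\<forall>i<m. \<forall>h\<in>tuples V i. bounded_linear_map_on Y N V (\<lambda>f. L i f h)) \<and>
    (\<forall>f\<in>Y. S f = sample_list L m f))"

definition scalar_sampling_operator ::
    "('a \<Rightarrow> real) set \<Rightarrow> (('a \<Rightarrow> real) \<Rightarrow> real) \<Rightarrow> nat \<Rightarrow> (('a \<Rightarrow> real) \<Rightarrow> real list) \<Rightarrow> bool"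
  where "scalar_sampling_operator Y N m S \<longleftrightarrow> adaptive_map Y N UNIV m S"

definition banach_sampling_operator ::
    "'a measure \<Rightarrow> 'v::real_normed_vector set \<Rightarrow> ('a \<Rightarrow> 'v) set \<Rightarrow> (('a \<Rightarrow> 'v) \<Rightarrow> real) \<Rightarrow>
     nat \<Rightarrow> (('a \<Rightarrow> 'v) \<Rightarrow> 'v list) \<Rightarrow> bool"
  where "banach_sampling_operator M V Y N m S \<longleftrightarrow>
    adaptive_map Y N V m S \<and>
    (\<exists>v\<in>V - {0}. \<exists>w\<in>V - {0}. \<exists>Y' N' S'.
      normed_L2_subspace M (UNIV :: real set) Y' N' \<and>
      scalar_sampling_operator Y' N' m S' \<and>
      (\<forall>g\<in>L2_space M (UNIV :: real set). (\<lambda>y. g y *\<^sub>R v) \<in> Y \<longrightarrow>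
        g \<in> Y' \<and> S (\<lambda>y. g y *\<^sub>R v) = map (\<lambda>x. x *\<^sub>R w) (S' g)))"


section \<open>Widths\<close>

text \<open>\<open>adaptive_width\<close> has values in \<open>ennreal\<close>: it is \<open>\<infinity>\<close> if there is no admissible sampling
  operator, as for \<open>V = {0}\<close>, and reconstruction maps with unbounded error cause no problem.\<close>

definition adaptive_width ::
    "'a measure \<Rightarrow> 'v::real_normed_vector set \<Rightarrow> ('a \<Rightarrow> 'v) set \<Rightarrow> (('a \<Rightarrow> 'v) \<Rightarrow> real) \<Rightarrow>
     nat \<Rightarrow> ('a \<Rightarrow> 'v) set \<Rightarrow> ennreal"
  where "adaptive_width M V Y N m K =
    (INF (S, T) \<in> {(S, T). banach_sampling_operator M V Y N m S \<and> T \<in> tuples V m \<rightarrow> L2_space M V}.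
      SUP f\<in>K. ennreal (L2_norm M (\<lambda>y. f y - T (S f) y)))"

definition theta_b ::
    "(nat \<Rightarrow> real) measure \<Rightarrow> 'v::complex_banach set \<Rightarrow> ((nat \<Rightarrow> real) \<Rightarrow> 'v) set \<Rightarrow>
     (((nat \<Rightarrow> real) \<Rightarrow> 'v) \<Rightarrow> real) \<Rightarrow> nat \<Rightarrow> (nat \<Rightarrow> real) \<Rightarrow> ennreal"
  where "theta_b M V Y N m b = adaptive_width M V Y N m (holo_class M V b)"

definition theta_sup_pM ::
    "(nat \<Rightarrow> real) measure \<Rightarrow> 'v::complex_banach set \<Rightarrow> ((nat \<Rightarrow> real) \<Rightarrow> 'v) set \<Rightarrow>
     (((nat \<Rightarrow> real) \<Rightarrow> 'v) \<Rightarrow> real) \<Rightarrow> nat \<Rightarrow> real \<Rightarrow> ennreal"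
  where "theta_sup_pM M V Y N m p = (SUP b\<in>lpM_ball_nonneg p. theta_b M V Y N m b)"

definition theta_p ::
    "(nat \<Rightarrow> real) measure \<Rightarrow> 'v::complex_banach set \<Rightarrow> ((nat \<Rightarrow> real) \<Rightarrow> 'v) set \<Rightarrow>
     (((nat \<Rightarrow> real) \<Rightarrow> 'v) \<Rightarrow> real) \<Rightarrow> nat \<Rightarrow> real \<Rightarrow> ennreal"
  where "theta_p M V Y N m p = adaptive_width M V Y N m (holo_class_p M V p)"

definition theta_pM ::
    "(nat \<Rightarrow> real) measure \<Rightarrow> 'v::complex_banach set \<Rightarrow> ((nat \<Rightarrow> real) \<Rightarrow> 'v) set \<Rightarrow>
     (((nat \<Rightarrow> real) \<Rightarrow> 'v) \<Rightarrow> real) \<Rightarrow> nat \<Rightarrow> real \<Rightarrow> ennreal"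
  where "theta_pM M V Y N m p = adaptive_width M V Y N m (holo_class_pM M V p)"

end

theory Submission
  imports Defs
begin

text \<open>
  Let \<open>\<tau>\<close> and \<open>\<sigma>\<^sup>2\<close> be the mean and the variance of \<open>\<rho>\<close>. If \<open>\<bar>c j\<bar> \<le> b j / 3\<close> and \<open>\<Sum> b j \<le> 1\<close>, then
  \<open>(\<Sum> c j (y j - \<tau>)) v\<close> with a unit vector \<open>v\<close> lies in the class of \<open>b\<close>, because
  \<open>cmod (z j) \<le> (r j + 1 / r j) / 2\<close> on a Bernstein ellipse; its \<open>L\<^sup>2\<close> norm is \<open>\<sigma>\<close> times the Euclidean
  norm of \<open>c\<close>. An adaptive method applied to such functions sees, as long as all samples vanish, only \<open>m\<close>
  fixed linear functionals of \<open>c\<close>, and it cannot tell a function in their common kernel from its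
  negative. So one needs kernel vectors of large Euclidean norm. For (b) the kernel in \<open>\<real>\<^sup>2\<^sup>m\<close> meets
  the unit cube in a vector with at least \<open>m\<close> coordinates equal to \<open>\<plusminus>1\<close>. For (a), Gaussian elimination
  with pivoting expresses all unit vectors modulo the kernel by at most \<open>m\<close> of them, with coefficients
  bounded by \<open>2 ^ m\<close>; in a large dimension two of these expressions nearly coincide by the pigeonhole
  principle, so the kernel contains a small perturbation of \<open>e a - e b\<close>.
\<close>

section \<open>Kernels of finitely many functionals\<close>

text \<open>Column \<open>j\<close> consists of the numbers \<open>l i j\<close>, and
  \<open>K\<close> collects the pivot columns. Each new functional adds at most one pivot. Pivoting
  on the largest defect keeps every multiplier at most 1 in absolute value, so one substitution at
  most doubles the bound on the coefficients.\<close>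

lemma elimination:
  fixes l :: "nat \<Rightarrow> 'i \<Rightarrow> real"
  assumes J: "finite J"
  shows "\<exists>K t. K \<subseteq> J \<and> card K \<le> m \<and> (\<forall>j\<in>J - K. \<forall>k\<in>K. \<bar>t j k\<bar> \<le> 2 ^ m) \<and>
    (\<forall>j\<in>J - K. \<forall>i<m. l i j = (\<Sum>k\<in>K. t j k * l i k))"
proof (induction m)
  case 0
  show ?case by (rule exI[of _ "{}"]) auto
next
  case (Suc m)
  then obtain K t where K: "K \<subseteq> J" "card K \<le> m"
    and t: "\<And>j k. j \<in> J - K \<Longrightarrow> k \<in> K \<Longrightarrow> \<bar>t j k\<bar> \<le> 2 ^ m"
    and l: "\<And>j i. j \<in> J - K \<Longrightarrow> i < m \<Longrightarrow> l i j = (\<Sum>k\<in>K. t j k * l i k)"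
    by blast
  have finK: "finite K"
    using K(1) J by (rule finite_subset)
  \<comment> \<open>The defect of column \<open>j\<close> in the new functional \<open>l m\<close>
    after the old expansion is substituted; if all defects vanish, the old pivots still
    suffice.\<close>
  define r where "r j = l m j - (\<Sum>k\<in>K. t j k * l m k)" for j
  show ?case
  proof (cases "\<forall>j\<in>J - K. r j = 0")
    case True
    have "\<bar>t j k\<bar> \<le> 2 ^ Suc m" if "j \<in> J - K" "k \<in> K" for j k
      using t[OF that] by simp
    moreover have "l i j = (\<Sum>k\<in>K. t j k * l i k)" if "j \<in> J - K" "i < Suc m" for i j
      using l[OF that(1)] True that by (cases "i = m") (auto simp: r_def)
    ultimately show ?thesis
      using K by (intro exI[of _ K] exI[of _ t]) auto
  next
    case False
    let ?A = "(\<lambda>j. \<bar>r j\<bar>) ` (J - K)"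
    have "Max ?A \<in> ?A"
      using False J by (intro Max_in) auto
    then obtain j0 where j0: "j0 \<in> J - K" and "\<bar>r j0\<bar> = Max ?A"
      by auto
    then have max: "\<bar>r j\<bar> \<le> \<bar>r j0\<bar>" if "j \<in> J - K" for j
      using that J by auto
    have r0: "r j0 \<noteq> 0"
      using False max by force
    define s where "s j = r j / r j0" for j
    have s: "\<bar>s j\<bar> \<le> 1" if "j \<in> J - K" for j
      using max[OF that] r0 by (simp add: s_def field_simps)
    \<comment> \<open>Subtracting \<open>s j\<close> times the relation of \<open>j0\<close> from
      that of \<open>j\<close> cancels the defect in \<open>l m\<close> and preserves the relations
      for \<open>i < m\<close>; the new pivot \<open>j0\<close> enters with coefficient
      \<open>s j\<close>.\<close>
    define t' where "t' j k = (if k = j0 then s j else t j k - s j * t j0 k)" for j k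
    have bound: "\<bar>t' j k\<bar> \<le> 2 ^ Suc m" if j: "j \<in> J - insert j0 K" and k: "k \<in> insert j0 K" for j k
    proof (cases "k = j0")
      case True
      then show ?thesis
        using s[of j] j one_le_power[of "2::real" "Suc m"] by (simp add: t'_def)
    next
      case False
      have "\<bar>s j * t j0 k\<bar> \<le> 1 * 2 ^ m"
        unfolding abs_mult using s[of j] t[of j0 k] j j0 k False by (intro mult_mono) auto
      then show ?thesis
        using t[of j k] j k False by (simp add: t'_def)
    qed
    have eq: "l i j = (\<Sum>k\<in>insert j0 K. t' j k * l i k)"
      if j: "j \<in> J - insert j0 K" and i: "i < Suc m" for i j
    proof -
      have "(\<Sum>k\<in>insert j0 K. t' j k * l i k) = s j * l i j0 + (\<Sum>k\<in>K. t' j k * l i k)"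
        using finK j0 by (simp add: t'_def)
      also have "(\<Sum>k\<in>K. t' j k * l i k) =
          (\<Sum>k\<in>K. t j k * l i k - s j * (t j0 k * l i k))"
        using j0 by (intro sum.cong) (auto simp: t'_def algebra_simps)
      also have "\<dots> = (\<Sum>k\<in>K. t j k * l i k) - s j * (\<Sum>k\<in>K. t j0 k * l i k)"
        by (simp add: sum_subtractf sum_distrib_left)
      also have "s j * l i j0 + \<dots> = l i j"
      proof (cases "i = m")
        case True
        have "(\<Sum>k\<in>K. t j k * l m k) = l m j - r j" "(\<Sum>k\<in>K. t j0 k * l m k) = l m j0 - r j0"
          by (simp_all add: r_def)
        then show ?thesis
          using True r0 by (simp add: s_def right_diff_distrib)
      next
        case False
        then show ?thesis
          using l[of j i] l[of j0 i] j j0 i by simp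
      qed
      finally show ?thesis ..
    qed
    have "insert j0 K \<subseteq> J" "card (insert j0 K) \<le> Suc m"
      using K j0 finK by auto
    with bound eq show ?thesis
      by blast
  qed
qed

text \<open>With more columns than functionals some column is not a pivot, and its expansion in the
  pivots is a nontrivial linear relation.\<close>

lemma exists_kernel_vector:
  fixes l :: "nat \<Rightarrow> 'i \<Rightarrow> real"
  assumes J: "finite J" and m: "m < card J"
  shows "\<exists>d. (\<exists>j\<in>J. d j \<noteq> 0) \<and> (\<forall>i<m. (\<Sum>j\<in>J. d j * l i j) = 0)"
proof -
  obtain K t where K: "K \<subseteq> J" "card K \<le> m"
    and l: "\<And>j i. j \<in> J - K \<Longrightarrow> i < m \<Longrightarrow> l i j = (\<Sum>k\<in>K. t j k * l i k)"
    using elimination[OF J, of m l] by blast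
  obtain j0 where j0: "j0 \<in> J - K"
    using K m by (cases "K = J") auto
  define d where "d j = (if j = j0 then 1 else if j \<in> K then - t j0 j else 0)" for j
  have "(\<Sum>j\<in>J. d j * l i j) = 0" if "i < m" for i
  proof -
    have "(\<Sum>j\<in>J. d j * l i j) = (\<Sum>j\<in>insert j0 K. d j * l i j)"
      using J j0 K by (intro sum.mono_neutral_right) (auto simp: d_def)
    also have "\<dots> = l i j0 + (\<Sum>j\<in>K. d j * l i j)"
      using j0 finite_subset[OF K(1) J] by (simp add: d_def)
    also have "(\<Sum>j\<in>K. d j * l i j) = - (\<Sum>j\<in>K. t j0 j * l i j)"
      unfolding sum_negf[symmetric] using j0 by (intro sum.cong) (auto simp: d_def)
    finally show ?thesis
      using l[OF j0 that] by simp
  qed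
  moreover have "d j0 \<noteq> 0"
    by (simp add: d_def)
  ultimately show ?thesis
    using j0 by blast
qed

text \<open>Start from 0 and move along a kernel direction supported on the coordinates that are not
  yet \<open>\<plusminus>1\<close>, until one more of them reaches the boundary. Such a direction
  exists while more than \<open>m\<close> coordinates are free.\<close>

lemma exists_kernel_vector_in_cube:
  fixes l :: "nat \<Rightarrow> 'i \<Rightarrow> real"
  assumes J: "finite J" and k: "k + m \<le> card J"
  shows "\<exists>c. (\<forall>j\<in>J. \<bar>c j\<bar> \<le> 1) \<and> (\<forall>i<m. (\<Sum>j\<in>J. c j * l i j) = 0) \<and>
    k \<le> card {j\<in>J. \<bar>c j\<bar> = 1}"
  using k
proof (induction k)
  case 0
  show ?case by (rule exI[of _ "\<lambda>_. 0"]) auto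
next
  case (Suc k)
  then obtain c where c1: "\<And>j. j \<in> J \<Longrightarrow> \<bar>c j\<bar> \<le> 1"
    and c0: "\<And>i. i < m \<Longrightarrow> (\<Sum>j\<in>J. c j * l i j) = 0"
    and ck: "k \<le> card {j\<in>J. \<bar>c j\<bar> = 1}"
    by auto
  let ?E = "{j\<in>J. \<bar>c j\<bar> = 1}"
  show ?case
  proof (cases "Suc k \<le> card ?E")
    case True
    with c1 c0 show ?thesis by blast
  next
    case False
    define I where "I = J - ?E"
    have "card I = card J - card ?E"
      unfolding I_def using J by (intro card_Diff_subset) auto
    \<comment> \<open>At most \<open>k\<close> of the at least \<open>Suc k + m\<close> coordinates
      are saturated.\<close>
    with False Suc.prems have "m < card I"
      by linarith
    then obtain d where dnz: "\<exists>j\<in>I. d j \<noteq> 0" and d0: "\<And>i. i < m \<Longrightarrow> (\<Sum>j\<in>I. d j * l i j) = 0"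
      using exists_kernel_vector[of I m l] J by (auto simp: I_def)
    define D where "D = {j\<in>I. d j \<noteq> 0}"
    have D: "finite D" "D \<noteq> {}"
      using dnz J by (auto simp: D_def I_def)
    \<comment> \<open>By this choice \<open>c j + s j * d j = sgn (d j)\<close>: it is the step
      length at which coordinate \<open>j\<close> reaches the boundary. The smallest of these,
      \<open>t\<close>, keeps all other coordinates in the cube.\<close>
    define s where "s j = (sgn (d j) - c j) / d j" for j
    define t where "t = Min (s ` D)"
    have c_lt: "\<bar>c j\<bar> < 1" if "j \<in> I" for j
      using c1[of j] that by (auto simp: I_def)
    have s_pos: "0 < s j" if "j \<in> D" for j
      using that c_lt[of j] by (auto simp: s_def D_def sgn_if zero_less_divide_iff)
    have t_le: "t \<le> s j" if "j \<in> D" for j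
      using that D by (simp add: t_def)
    have "t \<in> s ` D"
      unfolding t_def using D by (intro Min_in) auto
    then obtain j0 where j0: "j0 \<in> D" "t = s j0" by auto
    have t_pos: "0 < t"
      using j0 s_pos by simp
    define c' where "c' j = (if j \<in> D then c j + t * d j else c j)" for j
    have c'1: "\<bar>c' j\<bar> \<le> 1" if "j \<in> J" for j
    proof (cases "j \<in> D")
      case True
      then have dj: "d j \<noteq> 0" and lt: "\<bar>c j\<bar> < 1"
        using c_lt by (auto simp: D_def)
      have "t * \<bar>d j\<bar> \<le> s j * \<bar>d j\<bar>"
        using t_le[OF True] by (intro mult_right_mono) auto
      moreover have "0 \<le> t * \<bar>d j\<bar>"
        using t_pos by simp
      ultimately show ?thesis
        using dj lt True by (cases "d j > 0") (auto simp: c'_def s_def)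
    next
      case False
      then show ?thesis
        using c1[OF that] by (simp add: c'_def)
    qed
    have c'0: "(\<Sum>j\<in>J. c' j * l i j) = 0" if "i < m" for i
    proof -
      have "(\<Sum>j\<in>J. c' j * l i j) = (\<Sum>j\<in>J. c j * l i j + t * (if j \<in> D then d j * l i j else 0))"
        by (intro sum.cong) (auto simp: c'_def algebra_simps)
      also have "\<dots> = t * (\<Sum>j\<in>J. if j \<in> D then d j * l i j else 0)"
        using c0[OF that] by (simp add: sum.distrib sum_distrib_left)
      also have "(\<Sum>j\<in>J. if j \<in> D then d j * l i j else 0) = (\<Sum>j\<in>I. d j * l i j)"
        using J by (intro sum.mono_neutral_cong_right) (auto simp: D_def I_def)
      finally show ?thesis
        using d0[OF that] by simp
    qed
    have "\<bar>c' j0\<bar> = 1"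
      using j0 by (auto simp: c'_def s_def D_def sgn_if)
    moreover have "c' j = c j" if "j \<in> ?E" for j
      using that by (auto simp: c'_def D_def I_def)
    moreover have "j0 \<in> J - ?E"
      using j0 by (auto simp: D_def I_def)
    ultimately have "insert j0 ?E \<subseteq> {j\<in>J. \<bar>c' j\<bar> = 1}" "card (insert j0 ?E) = Suc (card ?E)"
      using J by auto
    then have "Suc k \<le> card {j\<in>J. \<bar>c' j\<bar> = 1}"
      using ck card_mono[of "{j\<in>J. \<bar>c' j\<bar> = 1}" "insert j0 ?E"] J by simp
    with c'1 c'0 show ?thesis by blast
  qed
qed

text \<open>The dimension \<open>n\<close> comes before the functionals \<open>l\<close>, since the
  width argument uses one dimension for all sampling operators. Two non-pivot columns with nearly
  equal expansions yield a kernel vector with entries 1 and - 1 and a small correction on at most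
  \<open>m\<close> pivots; the bound 4 is 2 for the two large entries plus 2 for the
  correction.\<close>

lemma exists_nearly_sparse_kernel_vector:
  fixes p :: real
  assumes p: "0 < p"
  shows "\<exists>n::nat. \<forall>l :: nat \<Rightarrow> nat \<Rightarrow> real. \<exists>c.
    (\<forall>i<m. (\<Sum>j<n. c j * l i j) = 0) \<and> (\<Sum>j<n. \<bar>c j\<bar> powr p) \<le> 4 \<and> 2 \<le> (\<Sum>j<n. (c j)\<^sup>2)"
proof -
  \<comment> \<open>With this mesh size at most \<open>m\<close> entries bounded by
    \<open>\<eta>\<close> contribute less than 2 to the sum of \<open>p\<close>-th powers.\<close>
  define \<eta> where "\<eta> = (2 / real (Suc m)) powr (1 / p)"
  have \<eta>: "0 < \<eta>" "\<eta> powr p = 2 / real (Suc m)"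
    using p by (simp_all add: \<eta>_def powr_powr)
  define R where "R = {\<lfloor>- (2 ^ m) / \<eta>\<rfloor>..\<lfloor>2 ^ m / \<eta>\<rfloor>}"
  have R: "finite R" by (simp add: R_def)
  have "0 \<le> 2 ^ m / \<eta>"
    using \<eta>(1) by simp
  then have "- 1 < 2 ^ m / \<eta>"
    by linarith
  then have "0 \<in> R"
    using \<eta>(1) by (simp add: R_def)
  then have R1: "1 \<le> card R"
    using R by (metis One_nat_def Suc_leI card_gt_0_iff empty_iff)
  \<comment> \<open>After removal of up to \<open>m\<close> pivots at least
    \<open>card R ^ m + 1\<close> columns remain, more than there are rounded coefficient
    vectors.\<close>
  define n where "n = Suc (card R ^ m + m)"
  have "\<exists>c. (\<forall>i<m. (\<Sum>j<n. c j * l i j) = 0) \<and> (\<Sum>j<n. \<bar>c j\<bar> powr p) \<le> 4 \<and>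
      2 \<le> (\<Sum>j<n. (c j)\<^sup>2)" for l :: "nat \<Rightarrow> nat \<Rightarrow> real"
  proof -
    obtain K t where K: "K \<subseteq> {..<n}" "card K \<le> m"
      and t: "\<And>j k. j \<in> {..<n} - K \<Longrightarrow> k \<in> K \<Longrightarrow> \<bar>t j k\<bar> \<le> 2 ^ m"
      and l: "\<And>j i. j \<in> {..<n} - K \<Longrightarrow> i < m \<Longrightarrow> l i j = (\<Sum>k\<in>K. t j k * l i k)"
      using elimination[of "{..<n}" m l] by blast
    have finK: "finite K"
      using K(1) by (rule finite_subset) simp
    \<comment> \<open>The coefficients of column \<open>j\<close> rounded to the mesh. Restriction
      to \<open>K\<close> places the vector in \<open>K \<rightarrow>\<^sub>E R\<close>, a set with
      at most \<open>card R ^ m\<close> elements.\<close>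
    define q where "q j = (\<lambda>k\<in>K. \<lfloor>t j k / \<eta>\<rfloor>)" for j
    have "q ` ({..<n} - K) \<subseteq> K \<rightarrow>\<^sub>E R"
    proof (intro image_subsetI)
      fix j assume j: "j \<in> {..<n} - K"
      have "\<lfloor>t j k / \<eta>\<rfloor> \<in> R" if "k \<in> K" for k
        using t[OF j that] \<eta>(1) unfolding R_def atLeastAtMost_iff
        by (intro conjI floor_mono divide_right_mono) auto
      then show "q j \<in> K \<rightarrow>\<^sub>E R"
        by (auto simp: q_def)
    qed
    then have "card (q ` ({..<n} - K)) \<le> card (K \<rightarrow>\<^sub>E R)"
      using finK R by (intro card_mono finite_PiE) auto
    also have "\<dots> \<le> card R ^ m"
      using finK K(2) R1 by (simp add: card_PiE power_increasing)
    also have "\<dots> < card ({..<n} - K)"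
      using K finK by (simp add: card_Diff_subset n_def)
    finally have "\<not> inj_on q ({..<n} - K)"
      by (rule pigeonhole)
    then obtain a b where ab: "a \<in> {..<n} - K" "b \<in> {..<n} - K" "a \<noteq> b" "q a = q b"
      by (auto simp: inj_on_def)
    \<comment> \<open>The difference of the relations of \<open>a\<close> and \<open>b\<close>;
      equal rounding bounds the entries on \<open>K\<close> by \<open>\<eta>\<close> in absolute
      value.\<close>
    define c where "c j = (if j = a then 1 else if j = b then - 1
      else if j \<in> K then t b j - t a j else 0)" for j
    have split: "(\<Sum>j<n. f j) = f a + f b + (\<Sum>k\<in>K. f k)"
      if "\<And>j. j \<notin> insert a (insert b K) \<Longrightarrow> f j = 0" for f :: "nat \<Rightarrow> real"
    proof -
      have "(\<Sum>j<n. f j) = (\<Sum>j\<in>insert a (insert b K). f j)"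
        using K ab that by (intro sum.mono_neutral_right) auto
      also have "\<dots> = f a + f b + (\<Sum>k\<in>K. f k)"
        using finK ab by (simp add: add.assoc)
      finally show ?thesis .
    qed
    have c_K: "c k = t b k - t a k" if "k \<in> K" for k
      using that ab by (auto simp: c_def)
    have "(\<Sum>j<n. c j * l i j) = 0" if "i < m" for i
    proof -
      have "(\<Sum>j<n. c j * l i j) = c a * l i a + c b * l i b + (\<Sum>k\<in>K. c k * l i k)"
        by (rule split) (auto simp: c_def)
      also have "(\<Sum>k\<in>K. c k * l i k) = (\<Sum>k\<in>K. t b k * l i k) - (\<Sum>k\<in>K. t a k * l i k)"
        unfolding sum_subtractf[symmetric] by (intro sum.cong) (simp_all add: c_K left_diff_distrib)
      finally show ?thesis
        using l[OF ab(1) that] l[OF ab(2) that] ab(3) by (simp add: c_def)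
    qed
    moreover have "(\<Sum>j<n. \<bar>c j\<bar> powr p) \<le> 4"
    proof -
      have small: "\<bar>c k\<bar> powr p \<le> 2 / real (Suc m)" if "k \<in> K" for k
      proof -
        have "\<lfloor>t a k / \<eta>\<rfloor> = \<lfloor>t b k / \<eta>\<rfloor>"
          using fun_cong[OF ab(4), of k] that by (simp add: q_def)
        then have "\<bar>t b k / \<eta> - t a k / \<eta>\<bar> \<le> 1"
          by linarith
        then have "\<bar>c k\<bar> \<le> \<eta>"
          using \<eta>(1) c_K[OF that] by (simp add: diff_divide_distrib[symmetric] field_simps)
        then have "\<bar>c k\<bar> powr p \<le> \<eta> powr p"
          using p by (intro powr_mono2) auto
        then show ?thesis
          by (simp add: \<eta>(2))
      qed
      have "(\<Sum>j<n. \<bar>c j\<bar> powr p) = \<bar>c a\<bar> powr p + \<bar>c b\<bar> powr p + (\<Sum>k\<in>K. \<bar>c k\<bar> powr p)"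
        by (rule split) (auto simp: c_def)
      also have "\<dots> = 2 + (\<Sum>k\<in>K. \<bar>c k\<bar> powr p)"
        using ab(3) by (simp add: c_def)
      also have "(\<Sum>k\<in>K. \<bar>c k\<bar> powr p) \<le> real (card K) * (2 / real (Suc m))"
        using small by (rule sum_bounded_above)
      also have "\<dots> \<le> real (Suc m) * (2 / real (Suc m))"
        using K(2) by (intro mult_right_mono) auto
      also have "\<dots> = 2"
        by (simp del: of_nat_Suc)
      finally show ?thesis by simp
    qed
    moreover have "2 \<le> (\<Sum>j<n. (c j)\<^sup>2)"
    proof -
      have "(\<Sum>j<n. (c j)\<^sup>2) = (c a)\<^sup>2 + (c b)\<^sup>2 + (\<Sum>k\<in>K. (c k)\<^sup>2)"
        by (rule split) (auto simp: c_def)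
      then show ?thesis
        using ab(3) by (simp add: c_def sum_nonneg)
    qed
    ultimately show ?thesis by blast
  qed
  then show ?thesis by blast
qed

section \<open>Lower bounds for adaptive widths\<close>

lemma strongly_measurable_compose:
  assumes "strongly_measurable M f" and "continuous_on UNIV h"
  shows "strongly_measurable M (\<lambda>y. h (f y))"
proof -
  obtain s where s: "\<And>n. simple_function M (s n)" "AE y in M. (\<lambda>n. s n y) \<longlonglongrightarrow> f y"
    using assms(1) by (auto simp: strongly_measurable_def)
  have "AE y in M. (\<lambda>n. h (s n y)) \<longlonglongrightarrow> h (f y)"
    using s(2) by eventually_elim (rule continuous_on_tendsto_compose[OF assms(2)], auto)
  then show ?thesis
    unfolding strongly_measurable_def using s(1)
    by (intro exI[of _ "\<lambda>n y. h (s n y)"]) (auto intro: simple_function_compose1)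
qed

text \<open>Since \<open>f\<close> and \<open>g\<close> are only almost everywhere limits of simple
  functions, the integrand itself may fail to be measurable when \<open>M\<close> is not complete.
  The liminf of the squared distances of the approximations is a measurable version of it.\<close>

lemma strongly_measurable_diff_sq_norm:
  fixes f g :: "'a \<Rightarrow> 'v::real_normed_vector"
  assumes "strongly_measurable M f" "strongly_measurable M g"
  shows "\<exists>u\<in>borel_measurable M. AE y in M. ennreal ((norm (f y - g y))\<^sup>2) = u y"
proof -
  obtain s t where s: "\<And>n. simple_function M (s n)" "AE y in M. (\<lambda>n. s n y) \<longlonglongrightarrow> f y"
    and t: "\<And>n. simple_function M (t n)" "AE y in M. (\<lambda>n. t n y) \<longlonglongrightarrow> g y"
    using assms by (auto simp: strongly_measurable_def)
  let ?d = "\<lambda>n y. ennreal ((norm (s n y - t n y))\<^sup>2)"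
  have "?d n \<in> borel_measurable M" for n
    using simple_function_compose2[OF s(1) t(1)] by (rule borel_measurable_simple_function)
  then have "(\<lambda>y. liminf (\<lambda>n. ?d n y)) \<in> borel_measurable M"
    by measurable
  moreover have "AE y in M. ennreal ((norm (f y - g y))\<^sup>2) = liminf (\<lambda>n. ?d n y)"
    using s(2) t(2)
  proof eventually_elim
    case (elim y)
    then have "(\<lambda>n. ?d n y) \<longlonglongrightarrow> ennreal ((norm (f y - g y))\<^sup>2)"
      by (intro tendsto_intros)
    then show ?case
      by (rule lim_imp_Liminf[symmetric, OF sequentially_bot])
  qed
  ultimately show ?thesis
    by (intro bexI[of _ "\<lambda>y. liminf (\<lambda>n. ?d n y)"])
qed

text \<open>Additivity of the integral asks for measurability, so both integrands are exchanged for
  measurable versions and back.\<close>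

lemma nn_integral_add_strongly_measurable:
  fixes f g f' g' :: "'a \<Rightarrow> 'v::real_normed_vector"
  assumes "strongly_measurable M f" "strongly_measurable M g"
    and "strongly_measurable M f'" "strongly_measurable M g'"
  shows "(\<integral>\<^sup>+ y. ennreal ((norm (f y - g y))\<^sup>2) + ennreal ((norm (f' y - g' y))\<^sup>2) \<partial>M) =
    (\<integral>\<^sup>+ y. ennreal ((norm (f y - g y))\<^sup>2) \<partial>M) + (\<integral>\<^sup>+ y. ennreal ((norm (f' y - g' y))\<^sup>2) \<partial>M)"
proof -
  obtain u u' where [measurable]: "u \<in> borel_measurable M" "u' \<in> borel_measurable M"
    and u: "AE y in M. ennreal ((norm (f y - g y))\<^sup>2) = u y"
    and u': "AE y in M. ennreal ((norm (f' y - g' y))\<^sup>2) = u' y"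
    using strongly_measurable_diff_sq_norm[OF assms(1,2)] strongly_measurable_diff_sq_norm[OF assms(3,4)]
    by blast
  have "(\<integral>\<^sup>+ y. ennreal ((norm (f y - g y))\<^sup>2) + ennreal ((norm (f' y - g' y))\<^sup>2) \<partial>M) =
      (\<integral>\<^sup>+ y. u y + u' y \<partial>M)"
    using u u' by (intro nn_integral_cong_AE) auto
  also have "\<dots> = integral\<^sup>N M u + integral\<^sup>N M u'"
    by (rule nn_integral_add) simp_all
  also have "integral\<^sup>N M u = (\<integral>\<^sup>+ y. ennreal ((norm (f y - g y))\<^sup>2) \<partial>M)"
    using u by (intro nn_integral_cong_AE) auto
  also have "integral\<^sup>N M u' = (\<integral>\<^sup>+ y. ennreal ((norm (f' y - g' y))\<^sup>2) \<partial>M)"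
    using u' by (intro nn_integral_cong_AE) auto
  finally show ?thesis .
qed

lemma sq_norm_diff_le:
  fixes a x :: "'v::real_normed_vector"
  shows "(norm (a - x))\<^sup>2 \<le> 2 * ((norm a)\<^sup>2 + (norm x)\<^sup>2)"
proof -
  have "(norm (a - x))\<^sup>2 \<le> (norm a + norm x)\<^sup>2"
    by (intro power_mono norm_triangle_ineq4) simp
  also have "\<dots> \<le> 2 * ((norm a)\<^sup>2 + (norm x)\<^sup>2)"
    using sum_squares_bound[of "norm a" "norm x"] by (simp add: power2_sum)
  finally show ?thesis .
qed

text \<open>A replacement for the parallelogram law in a general norm: \<open>2 a\<close> is the
  difference of \<open>a - x\<close> and \<open>- a - x\<close>.\<close>

lemma two_sq_norm_le:
  fixes a x :: "'v::real_normed_vector"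
  shows "2 * (norm a)\<^sup>2 \<le> (norm (a - x))\<^sup>2 + (norm (- a - x))\<^sup>2"
proof -
  have "2 * (2 * (norm a)\<^sup>2) = (norm ((a - x) - (- a - x)))\<^sup>2"
    by (simp add: scaleR_2[symmetric] power_mult_distrib)
  also have "\<dots> \<le> 2 * ((norm (a - x))\<^sup>2 + (norm (- a - x))\<^sup>2)"
    by (rule sq_norm_diff_le)
  finally show ?thesis by simp
qed

text \<open>Integrating \<open>two_sq_norm_le\<close> bounds twice the squared norm of
  \<open>f\<close> by the sum of the two squared distances, so one of them is at least the squared
  norm.\<close>

lemma L2_norm_le_max:
  assumes f: "f \<in> L2_space M V" and g: "g \<in> L2_space M V"
  shows "L2_norm M f \<le> max (L2_norm M (\<lambda>y. f y - g y)) (L2_norm M (\<lambda>y. - f y - g y))"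
proof -
  define I where "I h = (\<integral>\<^sup>+ y. ennreal ((norm (h y))\<^sup>2) \<partial>M)" for h :: "'a \<Rightarrow> 'b"
  have meas: "strongly_measurable M f" "strongly_measurable M g"
    and fin: "I f < \<infinity>" "I g < \<infinity>"
    using f g by (auto simp: L2_space_def I_def)
  have meas': "strongly_measurable M (\<lambda>y. - f y)" "strongly_measurable M (\<lambda>y. 0 :: 'b)"
    using strongly_measurable_compose[OF meas(1), of uminus]
      strongly_measurable_compose[OF meas(1), of "\<lambda>_. 0"]
    by (simp_all add: continuous_on_minus continuous_on_id)
  \<comment> \<open>As \<open>enn2real\<close> sends \<open>\<infinity>\<close> to 0, both distances
    must be known to be finite before passing to real numbers.\<close>
  have fin_diff: "I (\<lambda>y. h y - g y) < \<infinity>" if h: "strongly_measurable M h" "I h < \<infinity>" for h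
  proof -
    obtain u v where [measurable]: "u \<in> borel_measurable M" "v \<in> borel_measurable M"
      and u: "AE y in M. ennreal ((norm (h y - 0))\<^sup>2) = u y"
      and v: "AE y in M. ennreal ((norm (g y - 0))\<^sup>2) = v y"
      using strongly_measurable_diff_sq_norm[OF h(1) meas'(2)]
        strongly_measurable_diff_sq_norm[OF meas(2) meas'(2)] by blast
    have I_eq: "integral\<^sup>N M u = I h" "integral\<^sup>N M v = I g"
      unfolding I_def using u v by (auto intro!: nn_integral_cong_AE)
    have "I (\<lambda>y. h y - g y) \<le> (\<integral>\<^sup>+ y. 2 * (u y + v y) \<partial>M)"
      unfolding I_def
    proof (rule nn_integral_mono_AE)
      show "AE y in M. ennreal ((norm (h y - g y))\<^sup>2) \<le> 2 * (u y + v y)"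
        using u v
      proof eventually_elim
        case (elim y)
        have "ennreal ((norm (h y - g y))\<^sup>2) \<le> ennreal (2 * ((norm (h y))\<^sup>2 + (norm (g y))\<^sup>2))"
          by (rule ennreal_leI) (rule sq_norm_diff_le)
        with elim show ?case
          by (simp add: ennreal_mult)
      qed
    qed
    also have "\<dots> = 2 * (I h + I g)"
      by (simp add: nn_integral_cmult nn_integral_add I_eq)
    also have "\<dots> < \<infinity>"
      using fin h by (simp add: ennreal_mult_less_top)
    finally show ?thesis .
  qed
  let ?A = "I (\<lambda>y. f y - g y)" and ?B = "I (\<lambda>y. - f y - g y)"
  have finAB: "?A < \<infinity>" "?B < \<infinity>"
    using fin_diff[OF meas(1) fin(1)] fin_diff[OF meas'(1)] fin(1) by (auto simp: I_def)
  \<comment> \<open>Subtracting 0 brings the norm of \<open>f\<close> into the form required by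
    \<open>nn_integral_add_strongly_measurable\<close>.\<close>
  have "I f + I f = (\<integral>\<^sup>+ y. ennreal ((norm (f y - 0))\<^sup>2) + ennreal ((norm (f y - 0))\<^sup>2) \<partial>M)"
    unfolding I_def
    by (subst nn_integral_add_strongly_measurable[OF meas(1) meas'(2) meas(1) meas'(2)]) simp
  also have "\<dots> \<le> (\<integral>\<^sup>+ y. ennreal ((norm (f y - g y))\<^sup>2) + ennreal ((norm (- f y - g y))\<^sup>2) \<partial>M)"
  proof (rule nn_integral_mono)
    fix y
    have "ennreal ((norm (f y))\<^sup>2 + (norm (f y))\<^sup>2) \<le>
        ennreal ((norm (f y - g y))\<^sup>2 + (norm (- f y - g y))\<^sup>2)"
      using two_sq_norm_le[of "f y" "g y"] by (intro ennreal_leI) simp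
    then show "ennreal ((norm (f y - 0))\<^sup>2) + ennreal ((norm (f y - 0))\<^sup>2) \<le>
        ennreal ((norm (f y - g y))\<^sup>2) + ennreal ((norm (- f y - g y))\<^sup>2)"
      by (simp only: diff_zero ennreal_plus zero_le_power2)
  qed
  also have "\<dots> = ?A + ?B"
    unfolding I_def by (rule nn_integral_add_strongly_measurable[OF meas(1,2) meas'(1) meas(2)])
  finally have "enn2real (I f + I f) \<le> enn2real (?A + ?B)"
    using finAB by (intro enn2real_mono) auto
  then have "2 * enn2real (I f) \<le> enn2real ?A + enn2real ?B"
    using finAB fin by (simp add: enn2real_plus)
  then have "enn2real (I f) \<le> enn2real ?A \<or> enn2real (I f) \<le> enn2real ?B"
    by linarith
  then show ?thesis
    by (auto simp: L2_norm_def I_def le_max_iff_disj)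
qed

section \<open>Finite combinations in normed subspaces and zero samples\<close>

lemma normed_L2_subspace_subset: "normed_L2_subspace M V Y N \<Longrightarrow> Y \<subseteq> L2_space M V"
  unfolding normed_L2_subspace_def by (rule conjunct1)

lemma normed_L2_subspace_zero: "normed_L2_subspace M V Y N \<Longrightarrow> (\<lambda>y. 0) \<in> Y"
  unfolding normed_L2_subspace_def by (elim conjE)

lemma normed_L2_subspace_add:
  "normed_L2_subspace M V Y N \<Longrightarrow> f \<in> Y \<Longrightarrow> g \<in> Y \<Longrightarrow> (\<lambda>y. f y + g y) \<in> Y"
  by (simp add: normed_L2_subspace_def)

lemma normed_L2_subspace_scaleR:
  "normed_L2_subspace M V Y N \<Longrightarrow> f \<in> Y \<Longrightarrow> (\<lambda>y. c *\<^sub>R f y) \<in> Y"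
  by (simp add: normed_L2_subspace_def)

lemma normed_L2_subspace_sum:
  assumes Y: "normed_L2_subspace M V Y N" and J: "finite J" and h: "\<And>j. j \<in> J \<Longrightarrow> h j \<in> Y"
  shows "(\<lambda>y. \<Sum>j\<in>J. h j y) \<in> Y"
  using J h
proof (induction J)
  case empty
  show ?case
    using normed_L2_subspace_zero[OF Y] by simp
next
  case (insert j J)
  have "(\<lambda>y. \<Sum>j\<in>J. h j y) \<in> Y"
    using insert.prems by (intro insert.IH) simp
  with Y insert.prems[of j] have "(\<lambda>y. h j y + (\<Sum>j\<in>J. h j y)) \<in> Y"
    by (intro normed_L2_subspace_add) simp_all
  with insert.hyps show ?case by simp
qed

lemma bounded_linear_map_on_add:
  "bounded_linear_map_on Y N V A \<Longrightarrow> f \<in> Y \<Longrightarrow> g \<in> Y \<Longrightarrow> A (\<lambda>y. f y + g y) = A f + A g"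
  by (simp add: bounded_linear_map_on_def)

lemma bounded_linear_map_on_scaleR:
  "bounded_linear_map_on Y N V A \<Longrightarrow> f \<in> Y \<Longrightarrow> A (\<lambda>y. c *\<^sub>R f y) = c *\<^sub>R A f"
  by (simp add: bounded_linear_map_on_def)

lemma bounded_linear_map_on_sum:
  fixes c :: "'i \<Rightarrow> real"
  assumes Y: "normed_L2_subspace M U Y N" and A: "bounded_linear_map_on Y N V A"
    and J: "finite J" and h: "\<And>j. j \<in> J \<Longrightarrow> h j \<in> Y"
  shows "A (\<lambda>y. \<Sum>j\<in>J. c j *\<^sub>R h j y) = (\<Sum>j\<in>J. c j *\<^sub>R A (h j))"
  using J h
proof (induction J)
  case empty
  show ?case
    using bounded_linear_map_on_scaleR[OF A normed_L2_subspace_zero[OF Y], of 0]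
    by simp
next
  case (insert j J)
  have in_Y: "(\<lambda>y. c i *\<^sub>R h i y) \<in> Y" if "i \<in> insert j J" for i
    using Y insert.prems[OF that] by (rule normed_L2_subspace_scaleR)
  then have "(\<lambda>y. \<Sum>j\<in>J. c j *\<^sub>R h j y) \<in> Y"
    by (intro normed_L2_subspace_sum[OF Y insert.hyps(1)]) simp
  from bounded_linear_map_on_add[OF A in_Y[of j] this]
  have "A (\<lambda>y. c j *\<^sub>R h j y + (\<Sum>j\<in>J. c j *\<^sub>R h j y)) =
      A (\<lambda>y. c j *\<^sub>R h j y) + A (\<lambda>y. \<Sum>j\<in>J. c j *\<^sub>R h j y)"
    by simp
  also have "A (\<lambda>y. c j *\<^sub>R h j y) = c j *\<^sub>R A (h j)"
    using insert.prems[of j] by (intro bounded_linear_map_on_scaleR[OF A]) simp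
  finally show ?case
    using insert by simp
qed

text \<open>Adaptivity never gets a chance to react: as long as the earlier samples are 0, the next
  functional is the one attached to the zero history.\<close>

lemma sample_list_eq_zero:
  assumes "\<And>i. i < m \<Longrightarrow> L i f (replicate i 0) = 0"
  shows "sample_list L m f = replicate m 0"
  using assms
proof (induction m)
  case (Suc m)
  then show ?case by (simp add: replicate_append_same)
qed simp

text \<open>The functionals \<open>l\<close> below are the ones used along the zero history: a function in their common
  kernel cannot be distinguished from its negative, even by an adaptive method.\<close>

lemma adaptive_width_ge:
  fixes \<phi> :: "'i \<Rightarrow> 'a \<Rightarrow> real" and V :: "'v::real_normed_vector set"
  assumes Y: "normed_L2_subspace M V Y N" and KY: "K \<subseteq> Y"
    and V: "\<And>a x. x \<in> V \<Longrightarrow> a *\<^sub>R x \<in> V"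
    and J: "finite J"
    and \<phi>: "\<And>j. j \<in> J \<Longrightarrow> \<phi> j \<in> L2_space M UNIV"
    and \<phi>Y: "\<And>j v. j \<in> J \<Longrightarrow> v \<in> V \<Longrightarrow> (\<lambda>y. \<phi> j y *\<^sub>R v) \<in> Y"
    and K: "\<And>v (l :: nat \<Rightarrow> 'i \<Rightarrow> real). v \<in> V \<Longrightarrow> norm v = 1 \<Longrightarrow>
      \<exists>c. (\<forall>i<m. (\<Sum>j\<in>J. c j * l i j) = 0) \<and>
        (\<lambda>y. (\<Sum>j\<in>J. c j * \<phi> j y) *\<^sub>R v) \<in> K \<and> (\<lambda>y. - ((\<Sum>j\<in>J. c j * \<phi> j y) *\<^sub>R v)) \<in> K \<and>
        \<delta> \<le> L2_norm M (\<lambda>y. (\<Sum>j\<in>J. c j * \<phi> j y) *\<^sub>R v)"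
  shows "ennreal \<delta> \<le> adaptive_width M V Y N m K"
  unfolding adaptive_width_def
proof (rule INF_greatest, clarify)
  fix S T
  assume S: "banach_sampling_operator M V Y N m S" and T: "T \<in> tuples V m \<rightarrow> L2_space M V"
  obtain v w Y' N' S' where v: "v \<in> V" "v \<noteq> 0" and Y': "normed_L2_subspace M (UNIV :: real set) Y' N'"
    and S': "scalar_sampling_operator Y' N' m S'"
    and SS': "\<And>g. g \<in> L2_space M (UNIV :: real set) \<Longrightarrow> (\<lambda>y. g y *\<^sub>R v) \<in> Y \<Longrightarrow>
        g \<in> Y' \<and> S (\<lambda>y. g y *\<^sub>R v) = map (\<lambda>x. x *\<^sub>R w) (S' g)"
    using S unfolding banach_sampling_operator_def by blast
  obtain L where L: "\<And>i h. i < m \<Longrightarrow> h \<in> tuples UNIV i \<Longrightarrow> bounded_linear_map_on Y' N' UNIV (\<lambda>f. L i f h)"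
    and S'_eq: "\<And>f. f \<in> Y' \<Longrightarrow> S' f = sample_list L m f"
    using S' unfolding scalar_sampling_operator_def adaptive_map_def by blast
  have \<phi>Y': "\<phi> j \<in> Y'" if "j \<in> J" for j
    using SS'[OF \<phi>[OF that] \<phi>Y[OF that v(1)]] by blast
  \<comment> \<open>The direction \<open>v\<close> comes from the sampling operator and need not
    have norm 1, while the hypothesis on \<open>K\<close> speaks of unit vectors.\<close>
  define u where "u = (1 / norm v) *\<^sub>R v"
  have u: "u \<in> V" "norm u = 1"
    using v V by (auto simp: u_def)
  obtain c where c: "\<And>i. i < m \<Longrightarrow> (\<Sum>j\<in>J. c j * L i (\<phi> j) (replicate i 0)) = 0"
    and fK: "(\<lambda>y. (\<Sum>j\<in>J. c j * \<phi> j y) *\<^sub>R u) \<in> K" "(\<lambda>y. - ((\<Sum>j\<in>J. c j * \<phi> j y) *\<^sub>R u)) \<in> K"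
    and \<delta>: "\<delta> \<le> L2_norm M (\<lambda>y. (\<Sum>j\<in>J. c j * \<phi> j y) *\<^sub>R u)"
    using K[OF u, of "\<lambda>i j. L i (\<phi> j) (replicate i 0)"] by blast
  \<comment> \<open>Used with \<open>s = 1\<close> and \<open>s = - 1\<close>, so that one argument
    covers both signs.\<close>
  have zero: "S (\<lambda>y. (s * (\<Sum>j\<in>J. c j * \<phi> j y)) *\<^sub>R u) = replicate m 0"
    if s: "(\<lambda>y. (s * (\<Sum>j\<in>J. c j * \<phi> j y)) *\<^sub>R u) \<in> Y" for s
  proof -
    \<comment> \<open>The factor \<open>1 / norm v\<close> moves into the coefficients, which leaves
      a scalar function times \<open>v\<close>, the form that the link between \<open>S\<close> and
      \<open>S'\<close> requires.\<close>
    define c' where "c' j = s / norm v * c j" for j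
    let ?g = "\<lambda>y. \<Sum>j\<in>J. c' j *\<^sub>R \<phi> j y"
    have f_eq: "(\<lambda>y. (s * (\<Sum>j\<in>J. c j * \<phi> j y)) *\<^sub>R u) = (\<lambda>y. ?g y *\<^sub>R v)"
      by (simp add: c'_def u_def sum_distrib_left mult_ac fun_eq_iff)
    have "(\<lambda>y. c' j *\<^sub>R \<phi> j y) \<in> Y'" if "j \<in> J" for j
      using Y' \<phi>Y'[OF that] by (rule normed_L2_subspace_scaleR)
    then have g: "?g \<in> Y'"
      by (rule normed_L2_subspace_sum[OF Y' J])
    have "L i ?g (replicate i 0) = 0" if i: "i < m" for i
    proof -
      have "L i ?g (replicate i 0) = (\<Sum>j\<in>J. c' j *\<^sub>R L i (\<phi> j) (replicate i 0))"
        using \<phi>Y' by (intro bounded_linear_map_on_sum[OF Y' L J] i) (auto simp: tuples_def)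
      also have "\<dots> = s / norm v * (\<Sum>j\<in>J. c j * L i (\<phi> j) (replicate i 0))"
        by (simp add: c'_def sum_distrib_left mult_ac)
      finally show ?thesis
        using c[OF i] by simp
    qed
    then have "S' ?g = replicate m 0"
      unfolding S'_eq[OF g] by (intro sample_list_eq_zero)
    moreover have "?g \<in> L2_space M UNIV"
      using g normed_L2_subspace_subset[OF Y'] by blast
    ultimately show ?thesis
      using SS'[of ?g] s unfolding f_eq by (simp add: map_replicate_const)
  qed
  define f where "f y = (\<Sum>j\<in>J. c j * \<phi> j y) *\<^sub>R u" for y
  have f: "f \<in> K" "(\<lambda>y. - f y) \<in> K"
    using fK by (simp_all add: f_def[abs_def])
  have Sf: "S f = replicate m 0" "S (\<lambda>y. - f y) = replicate m 0"
    using zero[of 1] zero[of "- 1"] f KY by (auto simp: f_def[abs_def])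
  \<comment> \<open>The reconstruction from zero data, shared by \<open>f\<close> and its
    negative.\<close>
  define x where "x = T (replicate m 0)"
  have "0 \<in> V"
    using V[OF v(1), of 0] by simp
  then have "replicate m 0 \<in> tuples V m"
    by (auto simp: tuples_def)
  then have "x \<in> L2_space M V"
    unfolding x_def by (rule funcset_mem[OF T])
  moreover have "f \<in> L2_space M V"
    using f KY normed_L2_subspace_subset[OF Y] by blast
  ultimately have "L2_norm M f \<le> max (L2_norm M (\<lambda>y. f y - x y)) (L2_norm M (\<lambda>y. - f y - x y))"
    by (intro L2_norm_le_max)
  with \<delta> have "\<delta> \<le> L2_norm M (\<lambda>y. f y - x y) \<or> \<delta> \<le> L2_norm M (\<lambda>y. - f y - x y)"
    by (auto simp: f_def[abs_def])
  then obtain h where "h \<in> K" "\<delta> \<le> L2_norm M (\<lambda>y. h y - T (S h) y)"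
  proof
    assume "\<delta> \<le> L2_norm M (\<lambda>y. f y - x y)"
    then show thesis
      using f(1) Sf(1) that[of f] by (simp add: x_def)
  next
    assume "\<delta> \<le> L2_norm M (\<lambda>y. - f y - x y)"
    then show thesis
      using f(2) Sf(2) that[of "\<lambda>y. - f y"] by (simp add: x_def)
  qed
  then show "ennreal \<delta> \<le> (SUP f\<in>K. ennreal (L2_norm M (\<lambda>y. f y - T (S f) y)))"
    by (intro SUP_upper2[of h]) (auto intro: ennreal_leI)
qed

section \<open>Linear functions in the holomorphic classes\<close>

lemma integral_tensor_measure_mult:
  fixes \<phi> :: "real \<Rightarrow> real"
  assumes \<rho>: "prob_space \<rho>" and [measurable]: "\<phi> \<in> borel_measurable \<rho>"
    and int: "integrable \<rho> \<phi>" and mean: "(\<integral>x. \<phi> x \<partial>\<rho>) = 0"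
  shows "(\<integral>y. \<phi> (y i) * \<phi> (y j) \<partial>tensor_measure \<rho>) = (if i = j then \<integral>x. (\<phi> x)\<^sup>2 \<partial>\<rho> else 0)"
proof (cases "i = j")
  case True
  have "(\<integral>x. (\<phi> x)\<^sup>2 \<partial>\<rho>) = (\<integral>x. (\<phi> x)\<^sup>2 \<partial>distr (tensor_measure \<rho>) \<rho> (\<lambda>y. y j))"
    using \<rho> by (simp add: tensor_measure_def distr_PiM_component[of UNIV "\<lambda>_. \<rho>" j])
  also have "\<dots> = (\<integral>y. (\<phi> (y j))\<^sup>2 \<partial>tensor_measure \<rho>)"
    unfolding tensor_measure_def by (rule integral_distr) simp_all
  finally show ?thesis
    using True by (simp add: power2_eq_square)
next
  case False
  interpret \<rho>: prob_space \<rho> by fact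
  interpret product_prob_space "\<lambda>_. \<rho>" UNIV
    by unfold_locales
  \<comment> \<open>For distinct coordinates the restriction to \<open>{i, j}\<close> maps the
    tensor measure to a finite product, where the integral factors into two vanishing means.\<close>
  have "(\<integral>y. \<phi> (y i) * \<phi> (y j) \<partial>tensor_measure \<rho>) =
      (\<integral>y. (\<Prod>k\<in>{i, j}. \<phi> (restrict y {i, j} k)) \<partial>tensor_measure \<rho>)"
    using False by simp
  also have "\<dots> = (\<integral>y. (\<Prod>k\<in>{i, j}. \<phi> (y k))
      \<partial>distr (tensor_measure \<rho>) (Pi\<^sub>M {i, j} (\<lambda>_. \<rho>)) (\<lambda>y. restrict y {i, j}))"
    unfolding tensor_measure_def
    by (rule integral_distr[symmetric]) (simp_all add: measurable_restrict_subset del: restrict_apply)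
  also have "\<dots> = (\<integral>y. (\<Prod>k\<in>{i, j}. \<phi> (y k)) \<partial>Pi\<^sub>M {i, j} (\<lambda>_. \<rho>))"
    unfolding tensor_measure_def by (subst distr_PiM_restrict_finite) simp_all
  also have "\<dots> = (\<Prod>k\<in>{i, j}. \<integral>x. \<phi> x \<partial>\<rho>)"
    using int by (intro product_integral_prod) simp_all
  finally show ?thesis
    using False mean by simp
qed

text \<open>The functions \<open>\<phi> (y j)\<close> are orthogonal with equal norms, and
  boundedness gives the integrability needed to exchange sum and integral. For infinite
  \<open>J\<close> both sums are 0 by convention.\<close>

lemma integral_tensor_measure_sum_sq:
  fixes \<phi> :: "real \<Rightarrow> real"
  assumes \<rho>: "prob_space \<rho>" and [measurable]: "\<phi> \<in> borel_measurable \<rho>"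
    and bound: "\<And>x. x \<in> space \<rho> \<Longrightarrow> \<bar>\<phi> x\<bar> \<le> B" and mean: "(\<integral>x. \<phi> x \<partial>\<rho>) = 0"
  shows "(\<integral>y. (\<Sum>j\<in>J. c j * \<phi> (y j))\<^sup>2 \<partial>tensor_measure \<rho>) = (\<integral>x. (\<phi> x)\<^sup>2 \<partial>\<rho>) * (\<Sum>j\<in>J. (c j)\<^sup>2)"
proof (cases "finite J")
  case True
  interpret \<rho>: prob_space \<rho> by fact
  interpret M: prob_space "tensor_measure \<rho>"
    unfolding tensor_measure_def by (intro prob_space_PiM \<rho>)
  have int: "integrable \<rho> \<phi>"
    using bound by (intro \<rho>.integrable_const_bound[of _ B]) auto
  have "\<bar>\<phi> (y i) * \<phi> (y j)\<bar> \<le> B * B" if "y \<in> space (tensor_measure \<rho>)" for i j and y :: "nat \<Rightarrow> real"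
  proof -
    have "y i \<in> space \<rho>" "y j \<in> space \<rho>"
      using that by (auto simp: tensor_measure_def space_PiM)
    then show ?thesis
      unfolding abs_mult using bound[of "y i"] bound[of "y j"] by (intro mult_mono) auto
  qed
  moreover have "(\<lambda>y. \<phi> (y i) * \<phi> (y j)) \<in> borel_measurable (tensor_measure \<rho>)" for i j
    unfolding tensor_measure_def by simp
  ultimately have int2: "integrable (tensor_measure \<rho>) (\<lambda>y. \<phi> (y i) * \<phi> (y j))" for i j
    by (intro M.integrable_const_bound[of _ "B * B"]) auto
  have "(\<integral>y. (\<Sum>j\<in>J. c j * \<phi> (y j))\<^sup>2 \<partial>tensor_measure \<rho>) =
      (\<integral>y. (\<Sum>i\<in>J. \<Sum>j\<in>J. c i * c j * (\<phi> (y i) * \<phi> (y j))) \<partial>tensor_measure \<rho>)"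
    by (simp add: power2_eq_square sum_product mult_ac)
  also have "\<dots> = (\<Sum>i\<in>J. \<Sum>j\<in>J. c i * c j * (\<integral>y. \<phi> (y i) * \<phi> (y j) \<partial>tensor_measure \<rho>))"
    using int2 by simp
  also have "\<dots> = (\<Sum>i\<in>J. \<Sum>j\<in>J. if i = j then c i * c j * (\<integral>x. (\<phi> x)\<^sup>2 \<partial>\<rho>) else 0)"
    using integral_tensor_measure_mult[OF \<rho> _ int mean] by (intro sum.cong) auto
  also have "\<dots> = (\<integral>x. (\<phi> x)\<^sup>2 \<partial>\<rho>) * (\<Sum>j\<in>J. (c j)\<^sup>2)"
    using True by (simp add: sum_distrib_left power2_eq_square mult_ac)
  finally show ?thesis .
qed simp

section \<open>Affine functions on Bernstein polyellipses\<close>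

lemma cmod_ellipse_le:
  assumes "z \<in> ellipse r" "1 \<le> r"
  shows "cmod z \<le> (r + inverse r) / 2"
proof (cases "r = 1")
  case True
  then show ?thesis
    using assms by (auto simp: ellipse_def)
next
  case False
  then obtain w where z: "z = (w + inverse w) / 2" and w: "1 \<le> cmod w" "cmod w \<le> r"
    using assms by (auto simp: ellipse_def)
  have "cmod z \<le> (cmod w + inverse (cmod w)) / 2"
    unfolding z using norm_triangle_ineq[of w "inverse w"] by (simp add: norm_divide norm_inverse)
  also have "cmod w + inverse (cmod w) \<le> r + inverse r"
  proof -
    \<comment> \<open>The factorisation exhibits the monotonicity of \<open>x + inverse x\<close>:
      both factors are nonnegative for \<open>1 \<le> x\<close> and
      \<open>x \<le> r\<close>.\<close>
    have "r + inverse r - (x + inverse x) = (r - x) * (1 - inverse (r * x))" if "0 < x" for x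
      using that assms(2) by (simp add: field_simps)
    from this[of "cmod w"] have "r + inverse r - (cmod w + inverse (cmod w)) =
        (r - cmod w) * (1 - inverse (r * cmod w))"
      using w by linarith
    moreover have "inverse (r * cmod w) \<le> 1"
      using le_imp_inverse_le[of 1 "r * cmod w"] mult_mono[of 1 r 1 "cmod w"] w assms by simp
    ultimately show ?thesis
      using w by (smt (verit) mult_nonneg_nonneg)
  qed
  finally show ?thesis by simp
qed

text \<open>The distance of \<open>z j\<close> from \<open>\<tau>\<close> is at most
  \<open>q j + 2\<close>, where \<open>q j\<close> is the excess of the major semi-axis over 1.
  Weighted by \<open>b\<close>, the excesses sum to at most 1 by the definition of the region and
  the constants to at most 2; hence the divisor 3.\<close>

lemma norm_sum_holo_region_le:
  assumes z: "z \<in> holo_region b" and b: "\<And>i. 0 \<le> b i" and J: "finite J"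
    and sum_b: "(\<Sum>j\<in>J. b j) \<le> 1" and c: "\<And>j. j \<in> J \<Longrightarrow> \<bar>c j\<bar> \<le> b j / 3" and \<tau>: "\<bar>\<tau>\<bar> \<le> 1"
  shows "cmod (\<Sum>j\<in>J. of_real (c j) * (z j - of_real \<tau>)) \<le> 1"
proof -
  obtain r where r: "\<And>j. 1 \<le> r j" and zr: "\<And>j. z j \<in> ellipse (r j)"
    and sum_r: "(\<Sum>i. ennreal (((r i + inverse (r i)) / 2 - 1) * b i)) \<le> 1"
    using z by (auto simp: holo_region_def polyellipse_def)
  define q where "q j = (r j + inverse (r j)) / 2 - 1" for j
  have q: "0 \<le> q j" for j
  proof -
    have "(r j + inverse (r j)) / 2 - 1 = (r j - 1)\<^sup>2 / (2 * r j)"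
      using r[of j] by (simp add: field_simps power2_eq_square)
    then show ?thesis
      using r[of j] by (simp add: q_def)
  qed
  have "ennreal (\<Sum>j\<in>J. q j * b j) = (\<Sum>j\<in>J. ennreal (q j * b j))"
    using q b by (intro sum_ennreal[symmetric]) simp
  also have "\<dots> \<le> (\<Sum>j. ennreal (q j * b j))"
    using J by (intro sum_le_suminf) auto
  also have "\<dots> \<le> ennreal 1"
    using sum_r unfolding q_def by simp
  finally have "ennreal (\<Sum>j\<in>J. q j * b j) \<le> ennreal 1" .
  then have sum_q: "(\<Sum>j\<in>J. q j * b j) \<le> 1"
    by (subst (asm) ennreal_le_iff) auto
  have summand_le: "cmod (of_real (c j) * (z j - of_real \<tau>)) \<le> (q j * b j + 2 * b j) / 3" if "j \<in> J" for j
  proof -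
    have "cmod (z j - of_real \<tau>) \<le> cmod (z j) + cmod (of_real \<tau>)"
      by (rule norm_triangle_ineq4)
    also have "\<dots> \<le> q j + 2"
      using cmod_ellipse_le[OF zr[of j] r] \<tau> unfolding q_def norm_of_real by linarith
    finally have "\<bar>c j\<bar> * cmod (z j - of_real \<tau>) \<le> b j / 3 * (q j + 2)"
      using c[OF that] b[of j] by (intro mult_mono) auto
    moreover have "b j / 3 * (q j + 2) = (q j * b j + 2 * b j) / 3"
      by (simp add: algebra_simps)
    ultimately show ?thesis
      by (simp only: norm_mult norm_of_real)
  qed
  have "cmod (\<Sum>j\<in>J. of_real (c j) * (z j - of_real \<tau>)) \<le> (\<Sum>j\<in>J. (q j * b j + 2 * b j) / 3)"
    using summand_le by (rule sum_norm_le)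
  also have "\<dots> = ((\<Sum>j\<in>J. q j * b j) + 2 * (\<Sum>j\<in>J. b j)) / 3"
    by (simp add: sum.distrib sum_divide_distrib[symmetric] sum_distrib_left)
  also have "\<dots> \<le> 1"
    using sum_q sum_b by simp
  finally show ?thesis .
qed

lemma bounded_linear_scaleC: "bounded_linear (\<lambda>h. h *\<^sub>C (d :: 'v::complex_banach))"
proof (rule bounded_linear_intro[where K = "norm d"])
  show "(r *\<^sub>R x) *\<^sub>C d = r *\<^sub>R (x *\<^sub>C d)" for r x
    unfolding scaleR_conv_of_real scaleC_of_real[symmetric] scaleC_scaleC ..
qed (simp_all add: scaleC_add_left norm_scaleC)

lemma complex_differentiable_at_affine_scaleC:
  "complex_differentiable_at (\<lambda>w. (\<alpha> + \<beta> * w) *\<^sub>C v) w"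
proof -
  have "((\<lambda>w. \<alpha> + \<beta> * w) has_derivative (\<lambda>h. \<beta> * h)) (at w)"
    by (auto intro!: derivative_eq_intros)
  then have "((\<lambda>w. (\<alpha> + \<beta> * w) *\<^sub>C v) has_derivative (\<lambda>h. (\<beta> * h) *\<^sub>C v)) (at w)"
    by (rule bounded_linear.has_derivative[OF bounded_linear_scaleC])
  then show ?thesis
    unfolding complex_differentiable_at_def
    by (intro exI[of _ "\<beta> *\<^sub>C v"]) (simp add: scaleC_scaleC mult.commute)
qed

text \<open>Simple approximations of the real function \<open>g\<close>, multiplied by the fixed
  vector \<open>v\<close>, are simple approximations of the product, whose values all lie on one
  line.\<close>

lemma bounded_scaleR_in_L2_space:
  fixes g :: "'a \<Rightarrow> real"
  assumes M: "prob_space M" and g: "g \<in> borel_measurable M"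
    and bound: "\<And>y. y \<in> space M \<Longrightarrow> \<bar>g y\<bar> \<le> B" and V: "\<And>a. a *\<^sub>R v \<in> V"
  shows "(\<lambda>y. g y *\<^sub>R v) \<in> L2_space M V"
proof -
  interpret prob_space M by fact
  obtain s where s: "\<And>i. simple_function M (s i)" "\<And>y. y \<in> space M \<Longrightarrow> (\<lambda>i. s i y) \<longlonglongrightarrow> g y"
    using borel_measurable_implies_sequence_metric[OF g, of 0] by blast
  have "AE y in M. (\<lambda>i. s i y *\<^sub>R v) \<longlonglongrightarrow> g y *\<^sub>R v"
    using s(2) by (intro AE_I2 tendsto_scaleR tendsto_const)
  then have "strongly_measurable M (\<lambda>y. g y *\<^sub>R v)"
    unfolding strongly_measurable_def using s(1)
    by (intro exI[of _ "\<lambda>i y. s i y *\<^sub>R v"]) (auto intro: simple_function_compose1)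
  moreover have "(\<integral>\<^sup>+ y. ennreal ((norm (g y *\<^sub>R v))\<^sup>2) \<partial>M) < \<infinity>"
  proof -
    have "(\<integral>\<^sup>+ y. ennreal ((norm (g y *\<^sub>R v))\<^sup>2) \<partial>M) \<le> (\<integral>\<^sup>+ y. ennreal ((B * norm v)\<^sup>2) \<partial>M)"
      using bound by (intro nn_integral_mono ennreal_leI power_mono) (auto intro: mult_right_mono)
    also have "\<dots> < \<infinity>"
      by (simp add: emeasure_space_1)
    finally show ?thesis .
  qed
  ultimately show ?thesis
    using V by (auto simp: L2_space_def)
qed

lemma L2_norm_scaleR_unit:
  assumes "integrable M (\<lambda>y. (g y)\<^sup>2)" "norm v = 1"
  shows "L2_norm M (\<lambda>y. g y *\<^sub>R v) = sqrt (\<integral>y. (g y)\<^sup>2 \<partial>M)"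
  using assms by (simp add: L2_norm_def power_mult_distrib nn_integral_eq_integral)

lemma space_unit_interval:
  fixes \<rho> :: "real measure"
  assumes "sets \<rho> = sets (restrict_space borel {-1..1})"
  shows "space \<rho> = {-1..1}"
  using sets_eq_imp_space_eq[OF assms] by (simp add: space_restrict_space)

lemma borel_measurable_unit_interval:
  fixes \<rho> :: "real measure"
  assumes sets: "sets \<rho> = sets (restrict_space borel {-1..1})"
  shows "(\<lambda>x. x) \<in> borel_measurable \<rho>"
  unfolding measurable_cong_sets[OF sets refl] by (rule measurable_restrict_space1) simp

text \<open>The extension is the same formula with complex variables. It is affine in each variable,
  hence holomorphic with \<open>UNIV\<close> as the neighbourhood.\<close>

lemma linear_in_holo_class:
  fixes V :: "'v::complex_banach set"
  assumes \<rho>: "prob_space \<rho>" and sets: "sets \<rho> = sets (restrict_space borel {-1..1})"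
    and V: "closed_complex_subspace V" and v: "v \<in> V" "norm v = 1" and J: "finite J"
    and b: "\<And>i. 0 \<le> b i" "(\<Sum>j\<in>J. b j) \<le> 1" and c: "\<And>j. j \<in> J \<Longrightarrow> \<bar>c j\<bar> \<le> b j / 3" and \<tau>: "\<bar>\<tau>\<bar> \<le> 1"
  shows "(\<lambda>y. (\<Sum>j\<in>J. c j * (y j - \<tau>)) *\<^sub>R v) \<in> holo_class (tensor_measure \<rho>) V b"
proof -
  let ?F = "\<lambda>z. (\<Sum>j\<in>J. of_real (c j) * (z j - of_real \<tau>)) *\<^sub>C v"
  have space: "space \<rho> = {-1..1}"
    using sets by (rule space_unit_interval)
  have [measurable]: "(\<lambda>x. x) \<in> borel_measurable \<rho>"
    using sets by (rule borel_measurable_unit_interval)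
  have meas: "(\<lambda>y. \<Sum>j\<in>J. c j * (y j - \<tau>)) \<in> borel_measurable (tensor_measure \<rho>)"
    unfolding tensor_measure_def
    by (intro borel_measurable_sum borel_measurable_times borel_measurable_diff borel_measurable_const
        measurable_compose[OF measurable_component_singleton[of _ UNIV "\<lambda>_. \<rho>"]]) simp_all
  have VC: "a *\<^sub>C v \<in> V" for a
    using V v by (simp add: closed_complex_subspace_def)
  then have VR: "a *\<^sub>R v \<in> V" for a
    using VC[of "of_real a"] by (simp add: scaleC_of_real)
  have "\<bar>\<Sum>j\<in>J. c j * (y j - \<tau>)\<bar> \<le> (\<Sum>j\<in>J. \<bar>c j\<bar> * 2)" if "y \<in> space (tensor_measure \<rho>)" for y
  proof -
    have y: "\<bar>y j\<bar> \<le> 1" for j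
      using that space by (auto simp: tensor_measure_def space_PiM PiE_iff abs_le_iff)
    have "\<bar>c j * (y j - \<tau>)\<bar> \<le> \<bar>c j\<bar> * 2" for j
      unfolding abs_mult using y[of j] \<tau> by (intro mult_left_mono) auto
    then show ?thesis
      by (intro order.trans[OF sum_abs] sum_mono)
  qed
  then have L2: "(\<lambda>y. (\<Sum>j\<in>J. c j * (y j - \<tau>)) *\<^sub>R v) \<in> L2_space (tensor_measure \<rho>) V"
    by (intro bounded_scaleR_in_L2_space meas VR)
      (auto simp: tensor_measure_def intro: prob_space_PiM \<rho>)
  have "complex_differentiable_at (\<lambda>w. ?F (z(k := w))) (z k)" for z k
  proof -
    \<comment> \<open>\<open>\<alpha>\<close> is the value with coordinate \<open>k\<close> set to
      0, and \<open>\<beta>\<close> is the coefficient of that coordinate, which is 0 for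
      \<open>k\<close> outside \<open>J\<close>.\<close>
    define \<alpha> where "\<alpha> = (\<Sum>j\<in>J. of_real (c j) * ((z(k := 0)) j - of_real \<tau>))"
    define \<beta> where "\<beta> = (\<Sum>j\<in>J. if k = j then complex_of_real (c j) else 0)"
    have "(\<Sum>j\<in>J. of_real (c j) * ((z(k := w)) j - of_real \<tau>)) = \<alpha> + \<beta> * w" for w
      unfolding \<alpha>_def \<beta>_def sum_distrib_right sum.distrib[symmetric]
      by (intro sum.cong) (auto simp: algebra_simps)
    then show ?thesis
      by (simp only: complex_differentiable_at_affine_scaleC)
  qed
  then have "holomorphic_in V (holo_region b) ?F"
    unfolding holomorphic_in_def using VC by (intro exI[of _ UNIV]) simp
  moreover have "norm (?F z) \<le> 1" if "z \<in> holo_region b" for z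
    using norm_sum_holo_region_le[OF that b(1) J b(2) c \<tau>] v by (simp add: norm_scaleC)
  moreover have "?F (\<lambda>i. of_real (y i)) = (\<Sum>j\<in>J. c j * (y j - \<tau>)) *\<^sub>R v" for y
    by (simp add: scaleC_of_real[symmetric])
  ultimately show ?thesis
    using L2 unfolding holo_class_def by blast
qed

text \<open>The common form of both bounds: \<open>C\<close> is a set of admissible coefficient
  vectors, and it remains to find kernel vectors in \<open>C\<close> with a large sum of squares.
  The assumption \<open>unit\<close> serves to put the coordinate functions into \<open>Y\<close>,
  which is only known to be a normed subspace containing \<open>K\<close>.\<close>

lemma adaptive_width_linear_ge:
  fixes V :: "'v::complex_banach set"
  assumes \<rho>: "prob_space \<rho>" and sets: "sets \<rho> = sets (restrict_space borel {-1..1})"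
    and V: "closed_complex_subspace V" and Y: "normed_L2_subspace (tensor_measure \<rho>) V Y N"
    and KY: "K \<subseteq> Y" and \<tau>: "\<tau> = (\<integral>x. x \<partial>\<rho>)"
    and C: "\<And>c v. c \<in> C \<Longrightarrow> v \<in> V \<Longrightarrow> norm v = 1 \<Longrightarrow> (\<lambda>y. (\<Sum>j<n. c j * (y j - \<tau>)) *\<^sub>R v) \<in> K"
    and sym: "\<And>c. c \<in> C \<Longrightarrow> (\<lambda>j. - c j) \<in> C"
    and unit: "\<And>j. j < n \<Longrightarrow> \<exists>a. a \<noteq> 0 \<and> (\<lambda>i. if i = j then a else 0) \<in> C"
    and ker: "\<And>l :: nat \<Rightarrow> nat \<Rightarrow> real. \<exists>c\<in>C. (\<forall>i<m. (\<Sum>j<n. c j * l i j) = 0) \<and> s \<le> (\<Sum>j<n. (c j)\<^sup>2)"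
  shows "ennreal (sqrt ((\<integral>x. (x - \<tau>)\<^sup>2 \<partial>\<rho>) * s)) \<le> adaptive_width (tensor_measure \<rho>) V Y N m K"
proof -
  interpret \<rho>: prob_space \<rho> by fact
  interpret M: prob_space "tensor_measure \<rho>"
    unfolding tensor_measure_def by (intro prob_space_PiM \<rho>)
  have space: "space \<rho> = {-1..1}"
    using sets by (rule space_unit_interval)
  have meas [measurable]: "(\<lambda>x. x) \<in> borel_measurable \<rho>"
    using sets by (rule borel_measurable_unit_interval)
  have "integrable \<rho> (\<lambda>x. x)"
    using space by (intro \<rho>.integrable_const_bound[of _ 1] AE_I2) auto
  then have mean: "(\<integral>x. x - \<tau> \<partial>\<rho>) = 0"
    by (simp add: \<tau> \<rho>.prob_space)
  have bound: "\<bar>x - \<tau>\<bar> \<le> 1 + \<bar>\<tau>\<bar>" if "x \<in> space \<rho>" for x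
    using that space by auto
  have bound': "\<bar>y j - \<tau>\<bar> \<le> 1 + \<bar>\<tau>\<bar>" if "y \<in> space (tensor_measure \<rho>)" for y and j :: nat
    using that bound[of "y j"] by (auto simp: tensor_measure_def space_PiM)
  have meas' [measurable]: "(\<lambda>y. y j - \<tau>) \<in> borel_measurable (tensor_measure \<rho>)" for j
    unfolding tensor_measure_def
    by (intro borel_measurable_diff borel_measurable_const
        measurable_compose[OF measurable_component_singleton[of _ UNIV "\<lambda>_. \<rho>"]]) simp_all
  have VR: "a *\<^sub>R x \<in> V" if "x \<in> V" for a x
    using V that unfolding closed_complex_subspace_def by (metis scaleC_of_real)
  show ?thesis
  proof (rule adaptive_width_ge[OF Y KY VR, of "{..<n}" "\<lambda>j y. y j - \<tau>"])
    show "(\<lambda>y. y j - \<tau>) \<in> L2_space (tensor_measure \<rho>) UNIV" for j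
    proof -
      have "(\<lambda>y. (y j - \<tau>) *\<^sub>R (1 :: real)) \<in> L2_space (tensor_measure \<rho>) UNIV"
        by (rule bounded_scaleR_in_L2_space[OF M.prob_space_axioms meas' bound']) simp_all
      then show ?thesis by simp
    qed
    show "(\<lambda>y. (y j - \<tau>) *\<^sub>R v) \<in> Y" if j: "j \<in> {..<n}" and v: "v \<in> V" for j v
    proof (cases "v = 0")
      case True
      then show ?thesis
        using normed_L2_subspace_zero[OF Y] by simp
    next
      case False
      \<comment> \<open>A nonzero multiple of the coordinate function in \<open>K\<close> is enough,
        since \<open>Y\<close> is closed under scaling.\<close>
      obtain a where a: "a \<noteq> 0" "(\<lambda>i. if i = j then a else 0) \<in> C"
        using unit j by blast
      have "(\<Sum>i<n. (if i = j then a else 0) * (y i - \<tau>)) = a * (y j - \<tau>)" for y :: "nat \<Rightarrow> real"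
        using j by (simp add: if_distrib[of "\<lambda>x. x * _"] cong: if_cong)
      with C[OF a(2) VR[OF v, of "1 / norm v"]] KY False
      have "(\<lambda>y. (a * (y j - \<tau>)) *\<^sub>R (1 / norm v) *\<^sub>R v) \<in> Y"
        by auto
      from normed_L2_subspace_scaleR[OF Y this, of "norm v / a"] show ?thesis
        using a False by simp
    qed
    show "\<exists>c. (\<forall>i<m. (\<Sum>j<n. c j * l i j) = 0) \<and>
        (\<lambda>y. (\<Sum>j<n. c j * (y j - \<tau>)) *\<^sub>R v) \<in> K \<and> (\<lambda>y. - ((\<Sum>j<n. c j * (y j - \<tau>)) *\<^sub>R v)) \<in> K \<and>
        sqrt ((\<integral>x. (x - \<tau>)\<^sup>2 \<partial>\<rho>) * s) \<le>
          L2_norm (tensor_measure \<rho>) (\<lambda>y. (\<Sum>j<n. c j * (y j - \<tau>)) *\<^sub>R v)"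
      if v: "v \<in> V" "norm v = 1" for v and l :: "nat \<Rightarrow> nat \<Rightarrow> real"
    proof -
      obtain c where c: "c \<in> C" "\<And>i. i < m \<Longrightarrow> (\<Sum>j<n. c j * l i j) = 0" "s \<le> (\<Sum>j<n. (c j)\<^sup>2)"
        using ker[of l] by blast
      have "(\<Sum>j<n. c j * (y j - \<tau>))\<^sup>2 \<le> (\<Sum>j<n. \<bar>c j\<bar> * (1 + \<bar>\<tau>\<bar>))\<^sup>2"
        if "y \<in> space (tensor_measure \<rho>)" for y
      proof -
        have "\<bar>\<Sum>j<n. c j * (y j - \<tau>)\<bar> \<le> (\<Sum>j<n. \<bar>c j\<bar> * (1 + \<bar>\<tau>\<bar>))"
          using bound'[OF that]
          by (intro order.trans[OF sum_abs] sum_mono) (auto simp: abs_mult intro: mult_left_mono)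
        then show "(\<Sum>j<n. c j * (y j - \<tau>))\<^sup>2 \<le> (\<Sum>j<n. \<bar>c j\<bar> * (1 + \<bar>\<tau>\<bar>))\<^sup>2"
          by (metis abs_ge_zero power2_abs power_mono)
      qed
      then have int: "integrable (tensor_measure \<rho>) (\<lambda>y. (\<Sum>j<n. c j * (y j - \<tau>))\<^sup>2)"
        by (intro M.integrable_const_bound[of _ "(\<Sum>j<n. \<bar>c j\<bar> * (1 + \<bar>\<tau>\<bar>))\<^sup>2"] AE_I2) auto
      have "sqrt ((\<integral>x. (x - \<tau>)\<^sup>2 \<partial>\<rho>) * s) \<le> sqrt ((\<integral>x. (x - \<tau>)\<^sup>2 \<partial>\<rho>) * (\<Sum>j<n. (c j)\<^sup>2))"
        using c(3) by (intro real_sqrt_le_mono mult_left_mono) auto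
      also have "\<dots> = L2_norm (tensor_measure \<rho>) (\<lambda>y. (\<Sum>j<n. c j * (y j - \<tau>)) *\<^sub>R v)"
        unfolding L2_norm_scaleR_unit[OF int v(2)]
        by (subst integral_tensor_measure_sum_sq[OF \<rho> _ bound mean]) simp_all
      finally have "sqrt ((\<integral>x. (x - \<tau>)\<^sup>2 \<partial>\<rho>) * s) \<le>
          L2_norm (tensor_measure \<rho>) (\<lambda>y. (\<Sum>j<n. c j * (y j - \<tau>)) *\<^sub>R v)" .
      moreover have "(\<lambda>y. - ((\<Sum>j<n. c j * (y j - \<tau>)) *\<^sub>R v)) \<in> K"
        using C[OF sym[OF c(1)] v] by (simp only: mult_minus_left sum_negf scaleR_minus_left)
      ultimately show ?thesis
        using c(2) C[OF c(1) v] by blast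
    qed
  qed simp_all
qed

section \<open>Moments of the one-dimensional measure\<close>

lemma variance_pos:
  fixes \<rho> :: "real measure"
  assumes \<rho>: "prob_space \<rho>" and sets: "sets \<rho> = sets (restrict_space borel {-1..1})"
    and nondeg: "\<forall>x. measure \<rho> {x} \<noteq> 1"
  shows "0 < (\<integral>x. (x - \<tau>)\<^sup>2 \<partial>\<rho>)"
proof (rule ccontr)
  interpret \<rho>: prob_space \<rho> by fact
  have space: "space \<rho> = {-1..1}"
    using sets by (rule space_unit_interval)
  have [measurable]: "(\<lambda>x. x) \<in> borel_measurable \<rho>"
    using sets by (rule borel_measurable_unit_interval)
  have "(x - \<tau>)\<^sup>2 \<le> (1 + \<bar>\<tau>\<bar>)\<^sup>2" if "x \<in> space \<rho>" for x
    using that space abs_le_square_iff[of "x - \<tau>" "1 + \<bar>\<tau>\<bar>"] by auto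
  then have int: "integrable \<rho> (\<lambda>x. (x - \<tau>)\<^sup>2)"
    by (intro \<rho>.integrable_const_bound[of _ "(1 + \<bar>\<tau>\<bar>)\<^sup>2"] AE_I2) auto
  assume "\<not> ?thesis"
  moreover have "0 \<le> (\<integral>x. (x - \<tau>)\<^sup>2 \<partial>\<rho>)"
    by (intro Bochner_Integration.integral_nonneg) simp
  ultimately have "(\<integral>x. (x - \<tau>)\<^sup>2 \<partial>\<rho>) = 0" by linarith
  \<comment> \<open>Zero second moment about \<open>\<tau>\<close> concentrates all mass at
    \<open>\<tau>\<close>, against the assumption that no point has full mass.\<close>
  then have ae: "AE x in \<rho>. x = \<tau>"
    using integral_nonneg_eq_0_iff_AE[OF int] by simp
  \<comment> \<open>A point outside \<open>{-1..1}\<close> cannot carry the mass; membership also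
    makes \<open>{\<tau>}\<close> measurable.\<close>
  have "\<tau> \<in> space \<rho>"
  proof (rule ccontr)
    assume "\<tau> \<notin> space \<rho>"
    then have "AE x in \<rho>. x = \<tau> \<longrightarrow> False"
      by (intro AE_I2) auto
    from AE_mp[OF ae this] show False by simp
  qed
  then have "{\<tau>} \<in> sets \<rho>"
    unfolding sets space by (auto simp: sets_restrict_space)
  then have "measure \<rho> {\<tau>} = 1"
    using ae by (subst \<rho>.prob_eq_1) auto
  with nondeg show False by blast
qed

lemma abs_mean_le_1:
  fixes \<rho> :: "real measure"
  assumes \<rho>: "prob_space \<rho>" and sets: "sets \<rho> = sets (restrict_space borel {-1..1})"
  shows "\<bar>\<integral>x. x \<partial>\<rho>\<bar> \<le> 1"
proof -
  interpret \<rho>: prob_space \<rho> by fact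
  have bound: "\<bar>x\<bar> \<le> 1" if "x \<in> space \<rho>" for x
    using that space_unit_interval[OF sets] by auto
  have int: "integrable \<rho> (\<lambda>x. x)"
    using bound borel_measurable_unit_interval[OF sets]
    by (intro \<rho>.integrable_const_bound[of _ 1] AE_I2) auto
  have "\<bar>\<integral>x. x \<partial>\<rho>\<bar> \<le> (\<integral>x. \<bar>x\<bar> \<partial>\<rho>)"
    by (rule integral_abs_bound)
  also have "\<dots> \<le> (\<integral>x. 1 \<partial>\<rho>)"
    using int bound by (intro integral_mono) auto
  finally show ?thesis
    by (simp add: \<rho>.prob_space)
qed

section \<open>Lower bounds for the classes\<close>

text \<open>The entries are at most 1, so \<open>p < 1\<close> gives
  \<open>b i \<le> b i powr p\<close>. The third claim supplies the summability condition of
  \<open>linear_in_holo_class\<close>.\<close>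

lemma lp_ball_finite_support:
  assumes p: "0 < p" "p < 1" and b: "\<And>i. 0 \<le> b i" "\<And>i. n \<le> i \<Longrightarrow> b i = 0"
    and sum: "(\<Sum>i<n. b i powr p) \<le> 1"
  shows "b \<in> lp_space p" "lp_norm p b \<le> 1" "(\<Sum>i<n. b i) \<le> 1"
proof -
  have zero: "\<bar>b i\<bar> powr p = 0" if "i \<notin> {..<n}" for i
    using that b by simp
  show "b \<in> lp_space p"
    unfolding lp_space_def using summable_finite[OF finite_lessThan zero] by simp
  have "(\<Sum>i. \<bar>b i\<bar> powr p) = (\<Sum>i<n. b i powr p)"
    using suminf_finite[OF finite_lessThan zero] b(1) by simp
  then show "lp_norm p b \<le> 1"
    unfolding lp_norm_def using sum p by (simp add: powr_le1 sum_nonneg)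
  have le: "b i \<le> b i powr p" if "i < n" for i
  proof -
    have "b i powr p \<le> (\<Sum>i<n. b i powr p)"
      using that by (intro member_le_sum) auto
    then have "b i powr p \<le> 1" using sum by simp
    then have "b i \<le> 1"
      using p b(1)[of i] by (smt (verit) gr_one_powr)
    then show ?thesis
      using powr_mono'[of p 1 "b i"] p b(1)[of i] by simp
  qed
  then have "(\<Sum>i<n. b i) \<le> (\<Sum>i<n. b i powr p)"
    by (intro sum_mono) simp
  then show "(\<Sum>i<n. b i) \<le> 1"
    using sum by simp
qed

lemma monotone_majorant_eq:
  assumes "\<And>i. 0 \<le> b i" "antimono b"
  shows "monotone_majorant b = b"
proof
  fix i
  show "monotone_majorant b i = b i"
    unfolding monotone_majorant_def using assms
    by (intro cSup_eq_maximum) (auto dest: antimonoD)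
qed

text \<open>The excluded measures are the point masses, whose variance is 0. For all others
  \<open>\<sigma> / 3\<close> is a valid constant in both parts.\<close>

theorem theorem4p5:
  fixes \<rho> :: "real measure"
  assumes "prob_space \<rho>"
    and "sets \<rho> = sets (restrict_space borel {-1..1})"
    and "\<forall>x. measure \<rho> {x} \<noteq> 1"
  shows
    "(\<exists>c>0. \<forall>(V :: 'v::complex_banach set) Y N (m::nat) (p::real).
        closed_complex_subspace V \<longrightarrow> 1 \<le> m \<longrightarrow> 0 < p \<longrightarrow> p < 1 \<longrightarrow>
        normed_L2_subspace (tensor_measure \<rho>) V Y N \<longrightarrow>
        holo_class_p (tensor_measure \<rho>) V p \<subseteq> Y \<longrightarrow>
        theta_p (tensor_measure \<rho>) V Y N m p \<ge> ennreal (c * 2 powr (1 / 2 - 2 / p))) \<and>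
     (\<exists>c>0. \<forall>(V :: 'v::complex_banach set) Y N (m::nat) (p::real).
        closed_complex_subspace V \<longrightarrow> 1 \<le> m \<longrightarrow> 0 < p \<longrightarrow> p < 1 \<longrightarrow>
        normed_L2_subspace (tensor_measure \<rho>) V Y N \<longrightarrow>
        holo_class_pM (tensor_measure \<rho>) V p \<subseteq> Y \<longrightarrow>
        theta_pM (tensor_measure \<rho>) V Y N m p \<ge> theta_sup_pM (tensor_measure \<rho>) V Y N m p \<and>
        theta_sup_pM (tensor_measure \<rho>) V Y N m p \<ge>
          ennreal (c * 2 powr (- 1 / p) * real m powr (1 / 2 - 1 / p)))"
proof -
  let ?M = "tensor_measure \<rho>"
  interpret \<rho>: prob_space \<rho> by fact
  define \<tau> where "\<tau> = (\<integral>x. x \<partial>\<rho>)"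
  define \<sigma> where "\<sigma> = sqrt (\<integral>x. (x - \<tau>)\<^sup>2 \<partial>\<rho>)"
  have \<sigma>: "0 < \<sigma>" "\<sigma>\<^sup>2 = (\<integral>x. (x - \<tau>)\<^sup>2 \<partial>\<rho>)"
    using variance_pos[OF assms, of \<tau>] by (simp_all add: \<sigma>_def)
  have \<tau>: "\<bar>\<tau>\<bar> \<le> 1"
    unfolding \<tau>_def using assms(2) by (rule abs_mean_le_1[OF assms(1)])
  note in_class = linear_in_holo_class[OF assms(1,2) _ _ _ finite_lessThan _ _ _ \<tau>]
  note width_ge = adaptive_width_linear_ge[OF assms(1,2) _ _ _ \<tau>_def, folded \<sigma>(2)]
  have part_a: "ennreal (\<sigma> / 3 * 2 powr (1 / 2 - 2 / p)) \<le> theta_p ?M V Y N m p"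
    if V: "closed_complex_subspace V" and p: "0 < p" "p < 1"
      and Y: "normed_L2_subspace ?M V Y N" and KY: "holo_class_p ?M V p \<subseteq> Y"
    for V :: "'v set" and Y N m and p :: real
  proof -
    obtain n where n: "\<And>l :: nat \<Rightarrow> nat \<Rightarrow> real. \<exists>c. (\<forall>i<m. (\<Sum>j<n. c j * l i j) = 0) \<and>
        (\<Sum>j<n. \<bar>c j\<bar> powr p) \<le> 4 \<and> 2 \<le> (\<Sum>j<n. (c j)\<^sup>2)"
      using exists_nearly_sparse_kernel_vector[OF p(1), of m] by blast
    \<comment> \<open>Scaling by \<open>a\<close> turns the bound 4 on the sum of
      \<open>p\<close>-th powers into 1; moreover \<open>a = 2 powr (- 2 / p)\<close>.\<close>
    define a where "a = 4 powr (- 1 / p)"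
    have a: "0 < a" "a powr p = 1 / 4"
      unfolding a_def powr_powr using p by (simp_all add: powr_minus_divide)
    \<comment> \<open>Each \<open>c\<close> is placed in the class of its own \<open>b\<close>,
      equal to \<open>\<bar>3 * c j\<bar>\<close> for \<open>j < n\<close>; this is possible because
      the class in part (a) is a union over all \<open>b\<close>.\<close>
    let ?C = "{c. (\<Sum>j<n. \<bar>3 * c j\<bar> powr p) \<le> 1}"
    have "ennreal (sqrt (\<sigma>\<^sup>2 * (2 * (a / 3)\<^sup>2))) \<le> adaptive_width ?M V Y N m (holo_class_p ?M V p)"
    proof (rule width_ge[OF V Y KY, where C = ?C and n = n])
      show "(\<lambda>y. (\<Sum>j<n. c j * (y j - \<tau>)) *\<^sub>R v) \<in> holo_class_p ?M V p"
        if c: "c \<in> ?C" and v: "v \<in> V" "norm v = 1" for c v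
      proof -
        define b where "b j = (if j < n then \<bar>3 * c j\<bar> else 0)" for j
        have "0 \<le> b i" "n \<le> i \<Longrightarrow> b i = 0" for i
          by (simp_all add: b_def)
        moreover have "(\<Sum>j<n. b j powr p) \<le> 1"
          using c by (simp add: b_def)
        ultimately have b: "b \<in> lp_space p" "lp_norm p b \<le> 1" "(\<Sum>j<n. b j) \<le> 1"
          using lp_ball_finite_support[OF p] by blast+
        have "(\<lambda>y. (\<Sum>j<n. c j * (y j - \<tau>)) *\<^sub>R v) \<in> holo_class ?M V b"
          using b(3) by (intro in_class[OF V v]) (auto simp: b_def)
        moreover have "b \<in> lp_ball_nonneg p"
          using b by (simp add: lp_ball_nonneg_def b_def)
        ultimately show ?thesis
          by (auto simp: holo_class_p_def)
      qed
      show "\<exists>a. a \<noteq> 0 \<and> (\<lambda>i. if i = j then a else 0) \<in> ?C" if j: "j < n" for j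
      proof -
        have "(\<Sum>i<n. \<bar>3 * (if i = j then 1 / 3 else 0)\<bar> powr p) = (\<Sum>i<n. if i = j then 1 else 0)"
          by (intro sum.cong) auto
        then show ?thesis
          using j by (intro exI[of _ "1 / 3"]) simp
      qed
      show "\<exists>c\<in>?C. (\<forall>i<m. (\<Sum>j<n. c j * l i j) = 0) \<and> 2 * (a / 3)\<^sup>2 \<le> (\<Sum>j<n. (c j)\<^sup>2)"
        for l :: "nat \<Rightarrow> nat \<Rightarrow> real"
      proof -
        obtain d where d: "\<And>i. i < m \<Longrightarrow> (\<Sum>j<n. d j * l i j) = 0"
            "(\<Sum>j<n. \<bar>d j\<bar> powr p) \<le> 4" "2 \<le> (\<Sum>j<n. (d j)\<^sup>2)"
          using n[of l] by blast
        define c where "c j = a / 3 * d j" for j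
        have "(\<Sum>j<n. \<bar>3 * c j\<bar> powr p) = a powr p * (\<Sum>j<n. \<bar>d j\<bar> powr p)"
          using a(1) by (simp add: c_def abs_mult powr_mult sum_distrib_left)
        then have "c \<in> ?C"
          using d(2) a(2) by simp
        moreover have "(\<Sum>j<n. c j * l i j) = 0" if "i < m" for i
        proof -
          have "(\<Sum>j<n. c j * l i j) = a / 3 * (\<Sum>j<n. d j * l i j)"
            by (simp only: c_def mult.assoc sum_distrib_left)
          then show ?thesis
            using d(1)[OF that] by simp
        qed
        moreover have "2 * (a / 3)\<^sup>2 \<le> (\<Sum>j<n. (c j)\<^sup>2)"
        proof -
          have "(\<Sum>j<n. (c j)\<^sup>2) = (\<Sum>j<n. (d j)\<^sup>2) * (a / 3)\<^sup>2"
            unfolding c_def power_mult_distrib sum_distrib_right by (intro sum.cong refl mult.commute)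
          then show ?thesis
            using mult_right_mono[OF d(3), of "(a / 3)\<^sup>2"] by simp
        qed
        ultimately show ?thesis by blast
      qed
    qed simp
    also have "sqrt (\<sigma>\<^sup>2 * (2 * (a / 3)\<^sup>2)) = \<sigma> / 3 * (sqrt 2 * a)"
      using \<sigma>(1) a(1) by (simp add: real_sqrt_mult)
    also have "sqrt 2 * a = 2 powr (1 / 2 - 2 / p)"
    proof -
      have "4 powr (- 1 / p) = (2 powr 2) powr (- 1 / p)"
        by simp
      also have "\<dots> = 2 powr (- 2 / p)"
        unfolding powr_powr by simp
      finally show ?thesis
        by (simp add: a_def powr_half_sqrt[symmetric] powr_add[symmetric])
    qed
    finally show ?thesis
      by (simp add: theta_p_def)
  qed
  have part_b: "ennreal (\<sigma> / 3 * 2 powr (- 1 / p) * real m powr (1 / 2 - 1 / p)) \<le> theta_sup_pM ?M V Y N m p"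
    if V: "closed_complex_subspace V" and m: "1 \<le> m" and p: "0 < p" "p < 1"
      and Y: "normed_L2_subspace ?M V Y N" and KY: "holo_class_pM ?M V p \<subseteq> Y"
    for V :: "'v set" and Y N m and p :: real
  proof -
    \<comment> \<open>Twice as many coordinates as samples, so that a kernel vector in the cube has
      at least \<open>m\<close> saturated coordinates. The value \<open>a\<close> is chosen so that
      \<open>n\<close> equal entries have \<open>p\<close>-norm 1.\<close>
    define n where "n = 2 * m"
    define a where "a = real n powr (- 1 / p)"
    have a: "0 < a" "a powr p = 1 / real n"
      unfolding a_def powr_powr using p m by (simp_all add: n_def powr_minus_divide)
    define b where "b j = (if j < n then a else 0)" for j
    have "0 \<le> b i" "n \<le> i \<Longrightarrow> b i = 0" for i
      using a(1) by (simp_all add: b_def)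
    moreover have "(\<Sum>j<n. b j powr p) \<le> 1"
      using a m by (simp add: b_def n_def)
    ultimately have b: "b \<in> lp_space p" "lp_norm p b \<le> 1" "(\<Sum>j<n. b j) \<le> 1"
      using lp_ball_finite_support[OF p] by blast+
    \<comment> \<open>Constant and then zero, \<open>b\<close> is its own majorant. This single
      \<open>b\<close> is fixed before the sampling operator, which is why the bound holds already
      for the supremum of the widths.\<close>
    have "monotone_majorant b = b"
      using a(1) by (intro monotone_majorant_eq) (auto simp: b_def antimono_def)
    moreover have "range b \<subseteq> {0, a}"
      by (auto simp: b_def)
    then have "bounded (range b)"
      by (rule bounded_subset[rotated]) (simp add: finite_imp_bounded)
    ultimately have b_ball: "b \<in> lpM_ball_nonneg p"
      using b a(1) by (simp add: lpM_ball_nonneg_def lpM_space_def lpM_norm_def) (simp add: b_def)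
    then have KY': "holo_class ?M V b \<subseteq> Y"
      using KY by (auto simp: holo_class_pM_def)
    let ?C = "{c. \<forall>j<n. \<bar>c j\<bar> \<le> a / 3}"
    have "ennreal (sqrt (\<sigma>\<^sup>2 * (real m * (a / 3)\<^sup>2))) \<le> adaptive_width ?M V Y N m (holo_class ?M V b)"
    proof (rule width_ge[OF V Y KY', where C = ?C and n = n])
      show "(\<lambda>y. (\<Sum>j<n. c j * (y j - \<tau>)) *\<^sub>R v) \<in> holo_class ?M V b"
        if "c \<in> ?C" "v \<in> V" "norm v = 1" for c v
        using that a(1) b(3) by (intro in_class[OF V that(2,3)]) (auto simp: b_def)
      show "\<exists>x. x \<noteq> 0 \<and> (\<lambda>i. if i = j then x else 0) \<in> ?C" for j
        using a(1) by (intro exI[of _ "a / 3"]) auto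
      show "\<exists>c\<in>?C. (\<forall>i<m. (\<Sum>j<n. c j * l i j) = 0) \<and> real m * (a / 3)\<^sup>2 \<le> (\<Sum>j<n. (c j)\<^sup>2)"
        for l :: "nat \<Rightarrow> nat \<Rightarrow> real"
      proof -
        obtain d where d: "\<And>j. j < n \<Longrightarrow> \<bar>d j\<bar> \<le> 1" "\<And>i. i < m \<Longrightarrow> (\<Sum>j<n. d j * l i j) = 0"
            "m \<le> card {j\<in>{..<n}. \<bar>d j\<bar> = 1}"
          using exists_kernel_vector_in_cube[of "{..<n}" m m l] by (auto simp: n_def)
        define c where "c j = a / 3 * d j" for j
        have "\<bar>c j\<bar> \<le> a / 3" if "j < n" for j
          using mult_left_mono[OF d(1)[OF that], of "a / 3"] a(1) by (simp add: c_def abs_mult)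
        then have "c \<in> ?C" by simp
        moreover have "(\<Sum>j<n. c j * l i j) = 0" if "i < m" for i
        proof -
          have "(\<Sum>j<n. c j * l i j) = a / 3 * (\<Sum>j<n. d j * l i j)"
            by (simp only: c_def mult.assoc sum_distrib_left)
          then show ?thesis
            using d(2)[OF that] by simp
        qed
        moreover have "real m * (a / 3)\<^sup>2 \<le> (\<Sum>j<n. (c j)\<^sup>2)"
        proof -
          let ?E = "{j\<in>{..<n}. \<bar>d j\<bar> = 1}"
          have "real m * (a / 3)\<^sup>2 \<le> real (card ?E) * (a / 3)\<^sup>2"
            using d(3) by (intro mult_right_mono) auto
          also have "\<dots> = (\<Sum>j\<in>?E. (a / 3)\<^sup>2)"
            by simp
          also have "\<dots> = (\<Sum>j\<in>?E. (c j)\<^sup>2)"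
          proof (rule sum.cong)
            fix j assume "j \<in> ?E"
            then have "(d j)\<^sup>2 = 1"
              by (simp add: abs_square_eq_1)
            then show "(a / 3)\<^sup>2 = (c j)\<^sup>2"
              by (simp only: c_def power_mult_distrib mult_1_right)
          qed simp
          also have "\<dots> \<le> (\<Sum>j<n. (c j)\<^sup>2)"
            by (intro sum_mono2) auto
          finally show ?thesis .
        qed
        ultimately show ?thesis by blast
      qed
    qed simp
    also have "sqrt (\<sigma>\<^sup>2 * (real m * (a / 3)\<^sup>2)) = \<sigma> / 3 * (sqrt (real m) * a)"
      using \<sigma>(1) a(1) by (simp add: real_sqrt_mult)
    also have "sqrt (real m) * a = 2 powr (- 1 / p) * real m powr (1 / 2 - 1 / p)"
    proof -
      have "a = 2 powr (- 1 / p) * real m powr (- 1 / p)"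
        by (simp add: a_def n_def powr_mult)
      moreover have "sqrt (real m) * real m powr (- 1 / p) = real m powr (1 / 2 - 1 / p)"
        using m by (simp add: powr_half_sqrt[symmetric] powr_add[symmetric])
      ultimately show ?thesis
        by (metis mult.left_commute)
    qed
    finally have "ennreal (\<sigma> / 3 * 2 powr (- 1 / p) * real m powr (1 / 2 - 1 / p)) \<le> theta_b ?M V Y N m b"
      by (simp add: theta_b_def mult.assoc)
    also have "\<dots> \<le> theta_sup_pM ?M V Y N m p"
      unfolding theta_sup_pM_def using b_ball by (rule SUP_upper)
    finally show ?thesis .
  qed
  \<comment> \<open>Every pair \<open>(S, T)\<close> competes in both infima, and its error over the
    union is at least its error over one class.\<close>
  have mono: "theta_sup_pM ?M V Y N m p \<le> theta_pM ?M V Y N m p" for V :: "'v set" and Y N m p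
    unfolding theta_sup_pM_def theta_pM_def theta_b_def adaptive_width_def
  proof (intro SUP_least INF_mono bexI)
    fix b ST
    assume b: "b \<in> lpM_ball_nonneg p"
    show "(case ST of (S, T) \<Rightarrow> SUP f\<in>holo_class ?M V b. ennreal (L2_norm ?M (\<lambda>y. f y - T (S f) y))) \<le>
        (case ST of (S, T) \<Rightarrow> SUP f\<in>holo_class_pM ?M V p. ennreal (L2_norm ?M (\<lambda>y. f y - T (S f) y)))"
      using b by (cases ST) (auto simp: holo_class_pM_def intro!: SUP_subset_mono)
  qed
  have c: "0 < \<sigma> / 3"
    using \<sigma>(1) by simp
  show ?thesis
  proof (intro conjI exI[of _ "\<sigma> / 3"] allI impI)
    show "0 < \<sigma> / 3" "0 < \<sigma> / 3"
      by (rule c)+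
  qed (rule part_a part_b mono; assumption)+
qed

end
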